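(* Let $V_1,\dots,V_m\in\mathbb{C}^{n\times n}$ satisfy $\sum_{i=1}^mV_i^*V_i=I_n$ and let $\Psi(X)=\sum_{i=1}^mV_iXV_i^*$ on the space $\mathbf{S}_n$ of $n\times n$ Hermitian matrices. Define complex subspaces of $\mathbb{C}^{n\times n}$ by $$\mathcal{H}_0=\operatorname{span}\{I_n\},\qquad \mathcal{H}_{k+1}=\operatorname{span}\{V_i^*XV_j:\ X\in\mathcal{H}_k,\ i,j=1,\dots,m\},\quad k=0,1,\dots,$$ and let $\mathcal{G}_k$ be the orthogonal complement of $\mathcal{H}_k$ in $\mathbb{C}^{n\times n}$. The following conditions are equivalent: (1) There exists $k$ such that $\|\Psi^k\|_H^\star<1$. (2) The noncommutative Markov chain $\Pi_{k+1}=\Psi(\Pi_k)$, $k=1,2,\dots$, converges to a unique invariant measure regardless of the initial distribution; that is, there is a unique density matrix $\Pi$ with $\Psi(\Pi)=\Pi$, and every orbit started at a density matrix converges to $\Pi$. (3) The subspace $\bigcap_k\mathcal{G}_k$ does not contain a rank one matrix. (4) There exists $k_0\le n^2-1$ such that $\|\Psi^{k_0}\|_H^\star<1$.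
   Context: $k,k_0$ range over nonnegative integers. A density matrix is a positive semidefinite Hermitian $n\times n$ matrix of trace $1$; $\mathcal{P}(I_n)$ is the set of density matrices. With $\|X\|_1=\sum_i|\lambda_i(X)|$ the trace norm, for a linear trace-preserving positive map $F:\mathbf{S}_n\to\mathbf{S}_n$, $$\|F\|_H^\star=\sup_{\rho_1\ne\rho_2\in\mathcal{P}(I_n)}\frac{\|F(\rho_1)-F(\rho_2)\|_1}{\|\rho_1-\rho_2\|_1}$$ (with value $0$ if $n=1$). $\Psi^k$ is the $k$-th iterate of $\Psi$. Orthogonality in $\mathbb{C}^{n\times n}$ is with respect to the inner product $(A,B)\mapsto\operatorname{trace}(A^*B)$. *)

theory Defs
  imports "HOL-Analysis.Analysis" "HOL-Computational_Algebra.Polynomial"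
begin

text \<open>An \<open>n \<times> n\<close> complex matrix is an element of \<^typ>\<open>complex^'n^'n\<close>, with \<open>n = CARD('n) \<ge> 1\<close>.\<close>

definition cadj :: "complex^'n^'m \<Rightarrow> complex^'m^'n" where
  "cadj A = (\<chi> i j. cnj (A $ j $ i))"

text \<open>The library's \<open>*\<^sub>R\<close> on matrices is only the real scalar multiplication, and \<open>*s\<close> scales
  vectors; spans of matrices have to be taken over the complex numbers, with respect to:\<close>

definition cscale :: "complex \<Rightarrow> complex^'n^'m \<Rightarrow> complex^'n^'m" where
  "cscale c A = (\<chi> i j. c * A $ i $ j)"

interpretation cmat: vector_space "cscale :: complex \<Rightarrow> complex^'n^'m \<Rightarrow> complex^'n^'m"
  by unfold_locales (simp_all add: cscale_def vec_eq_iff algebra_simps)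

definition hermitian :: "complex^'n^'n \<Rightarrow> bool" where
  "hermitian A \<longleftrightarrow> cadj A = A"

text \<open>For Hermitian \<open>A\<close> the value \<open>x\<^sup>* A x\<close> is real, so taking its real part loses nothing.\<close>

definition psd :: "complex^'n^'n \<Rightarrow> bool" where
  "psd A \<longleftrightarrow> hermitian A \<and> (\<forall>x. 0 \<le> Re (\<Sum>i\<in>UNIV. cnj (x $ i) * (A *v x) $ i))"

definition density_matrices :: "(complex^'n^'n) set" where
  "density_matrices = {A. psd A \<and> trace A = 1}"

definition charpoly :: "complex^'n^'n \<Rightarrow> complex poly" where
  "charpoly A = det (\<chi> i j. (if i = j then [:0, 1:] else 0) - [:A $ i $ j:])"

text \<open>The sum of \<open>\<bar>\<lambda>\<^sub>i(X)\<bar>\<close>, eigenvalues being repeated according to their multiplicity as roots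
  of the characteristic polynomial. It is the trace norm for Hermitian \<open>X\<close> only.\<close>

definition trace_norm :: "complex^'n^'n \<Rightarrow> real" where
  "trace_norm X = (\<Sum>z\<in>#proots (charpoly X). cmod z)"

text \<open>The supremum is taken in \<^typ>\<open>ennreal\<close>, so that it always exists and the supremum of the
  empty set, which occurs exactly for \<open>n = 1\<close>, is \<open>0\<close>.\<close>

definition dual_hilbert_norm :: "(complex^'n^'n \<Rightarrow> complex^'n^'n) \<Rightarrow> ennreal" where
  "dual_hilbert_norm F =
     (SUP (\<rho>\<^sub>1, \<rho>\<^sub>2) \<in> {(\<rho>\<^sub>1, \<rho>\<^sub>2). \<rho>\<^sub>1 \<in> density_matrices \<and> \<rho>\<^sub>2 \<in> density_matrices \<and> \<rho>\<^sub>1 \<noteq> \<rho>\<^sub>2}.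
        ennreal (trace_norm (F \<rho>\<^sub>1 - F \<rho>\<^sub>2) / trace_norm (\<rho>\<^sub>1 - \<rho>\<^sub>2)))"

definition kraus_map :: "nat \<Rightarrow> (nat \<Rightarrow> complex^'n^'n) \<Rightarrow> complex^'n^'n \<Rightarrow> complex^'n^'n" where
  "kraus_map m V X = (\<Sum>i=1..m. V i ** X ** cadj (V i))"

primrec kraus_space :: "nat \<Rightarrow> (nat \<Rightarrow> complex^'n^'n) \<Rightarrow> nat \<Rightarrow> (complex^'n^'n) set" where
  "kraus_space m V 0 = cmat.span {mat 1}"
| "kraus_space m V (Suc k) =
     cmat.span {cadj (V i) ** X ** V j | X i j. X \<in> kraus_space m V k \<and> i \<in> {1..m} \<and> j \<in> {1..m}}"

definition orth_compl :: "(complex^'n^'n) set \<Rightarrow> (complex^'n^'n) set" where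
  "orth_compl S = {A. \<forall>B\<in>S. trace (cadj A ** B) = 0}"

text \<open>The Markov chain \<open>\<Pi>\<^bsub>k+1\<^esub> = F(\<Pi>\<^sub>k)\<close>, \<open>k = 1, 2, \<dots>\<close>, converges to a unique invariant density
  matrix regardless of its initial distribution \<open>\<Pi>\<^sub>1\<close>. The value of the sequence at \<open>0\<close> is
  irrelevant.\<close>

definition converges_to_unique_invariant :: "(complex^'n^'n \<Rightarrow> complex^'n^'n) \<Rightarrow> bool" where
  "converges_to_unique_invariant F \<longleftrightarrow>
     (\<exists>P. P \<in> density_matrices \<and> F P = P \<and>
        (\<forall>Q\<in>density_matrices. F Q = Q \<longrightarrow> Q = P) \<and>
        (\<forall>R. R 1 \<in> density_matrices \<and> (\<forall>k\<ge>1. R (k + 1) = F (R k)) \<longrightarrow> R \<longlonglongrightarrow> P))"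

end

theory Submission
  imports Defs
begin

text \<open>Write \<open>\<Psi>\<close> for the map and expand its iterates: \<open>\<Psi>\<^sup>k(X)\<close> is the sum of \<open>W\<^sub>a X W\<^sub>a\<^sup>*\<close> over all words \<open>a\<close> of
length \<open>k\<close>, where \<open>W\<^sub>a\<close> is a product of \<open>k\<close> of the \<open>V\<^sub>i\<close>, and \<open>\<H>\<^sub>k\<close> is the span of the products
\<open>W\<^sub>a\<^sup>* W\<^sub>b\<close>. A rank one matrix has the form \<open>x y\<^sup>*\<close>, and it is orthogonal to \<open>\<H>\<^sub>k\<close> if and only if
\<open>W\<^sub>a x\<close> is orthogonal to \<open>W\<^sub>b y\<close> for all words \<open>a, b\<close> of length \<open>k\<close>
(\<open>outer_orthogonal_kraus_space\<close>). In other words, \<open>\<Psi>\<^sup>k(x x\<^sup>*)\<close> and \<open>\<Psi>\<^sup>k(y y\<^sup>*)\<close> have orthogonal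
ranges: the images of two pure states at time \<open>k\<close> are still perfectly distinguishable.

A contracting iterate forces convergence (\<open>contraction_imp_convergence\<close>): an invariant density matrix exists by Brouwer's
theorem, because the density matrices form a compact convex set. Along any orbit the trace norm
distance to it is bounded by \<open>2\<close> and shrinks by a constant factor in every \<open>k\<close> steps. Uniqueness
follows, as the constant orbit of a second invariant density matrix has to converge to the first.

Convergence excludes rank one matrices (\<open>convergence_imp_no_rank_1\<close>): if \<open>x y\<^sup>*\<close> is orthogonal to every \<open>\<H>\<^sub>k\<close>, with \<open>x\<close> and
\<open>y\<close> normalised, then \<open>\<Psi>\<^sup>k(x x\<^sup>*) \<Psi>\<^sup>k(y y\<^sup>*) = 0\<close> for all \<open>k\<close>. Both factors tend to the same \<open>\<Pi>\<close>, so
\<open>\<Pi>\<^sup>2 = 0\<close>, which is absurd for a Hermitian matrix of trace \<open>1\<close>.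

Absence of rank one matrices gives an early contraction: the \<open>\<H>\<^sub>k\<close> increase, since the \<open>V\<^sub>i\<^sup>* V\<^sub>i\<close> sum to the identity, and once two consecutive
ones agree they stay constant. As \<open>\<H>\<^sub>0\<close> has dimension \<open>1\<close> this happens for some \<open>k \<le> n\<^sup>2 - 1\<close>
(\<open>kraus_space_stabilizes\<close>), and for this \<open>k\<close> already the complement of \<open>\<H>\<^sub>k\<close> contains no rank one
matrix. Compactness of the unit sphere turns this into a uniform lower bound for the overlap of the
families \<open>W\<^sub>a x\<close> and \<open>W\<^sub>b y\<close> (\<open>overlap_lower_bound\<close>). It remains to deduce that \<open>\<Psi>\<^sup>k\<close> contracts the
trace norm of traceless Hermitian matrices \<open>D\<close> (\<open>kraus_trace_norm_contraction\<close>), and here the problem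
becomes classical. In eigenbases \<open>f\<close> of \<open>D\<close> and \<open>g\<close> of \<open>\<Psi>\<^sup>k(D)\<close>, the eigenvalues of \<open>\<Psi>\<^sup>k(D)\<close> arise
from those of \<open>D\<close> through the stochastic matrix with entries
\<open>p\<^sub>i\<^sub>j = (\<Sum>\<^sub>a \<bar>\<langle>W\<^sub>a f\<^sub>i, g\<^sub>j\<rangle>\<bar>\<^sup>2)\<close>; the overlap bound says that any two rows of \<open>p\<close> have a common part
of definite size, and Dobrushin's argument (\<open>stochastic_contraction\<close>) applies.

This closes the cycle, as an early contraction is a contraction. The trace norm, defined by the roots of the characteristic polynomial, is
made accessible by the spectral theorem: it is the sum of the absolute values of the eigenvalues of
any orthonormal eigenbasis (\<open>trace_norm_eigenbasis\<close>).\<close>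

section \<open>The complex inner product\<close>

text \<open>The inner product \<open>\<bullet>\<close> of \<^typ>\<open>complex^'n\<close> as a real Euclidean space is the real part of this form.\<close>

definition hdot :: "complex^'n \<Rightarrow> complex^'n \<Rightarrow> complex" where
  "hdot x y = (\<Sum>i\<in>UNIV. cnj (x $ i) * y $ i)"

definition outer :: "complex^'n \<Rightarrow> complex^'n \<Rightarrow> complex^'n^'n" where
  "outer x y = (\<chi> i j. x $ i * cnj (y $ j))"

lemma hdot_add_left: "hdot (x + y) z = hdot x z + hdot y z"
  and hdot_add_right: "hdot z (x + y) = hdot z x + hdot z y"
  and hdot_diff_right: "hdot z (x - y) = hdot z x - hdot z y"
  by (simp_all add: hdot_def algebra_simps sum.distrib sum_subtractf)

lemma hdot_scale_left: "hdot (c *s x) z = cnj c * hdot x z"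
  and hdot_scale_right: "hdot z (c *s x) = c * hdot z x"
  by (simp_all add: hdot_def algebra_simps sum_distrib_left)

lemma hdot_sum_right: "hdot z (\<Sum>i\<in>S. g i) = (\<Sum>i\<in>S. hdot z (g i))"
  by (simp add: hdot_def sum_distrib_left) (rule sum.swap)

lemma hdot_zero_right [simp]: "hdot x 0 = 0"
  by (simp add: hdot_def)

lemma cnj_hdot: "cnj (hdot x y) = hdot y x"
  by (simp add: hdot_def mult.commute)

lemma cmod_hdot_commute: "cmod (hdot x y) = cmod (hdot y x)"
  by (metis cnj_hdot complex_mod_cnj)

lemma hdot_self: "hdot x x = of_real ((norm x)\<^sup>2)"
proof -
  have "(norm x)\<^sup>2 = (\<Sum>i\<in>UNIV. (cmod (x $ i))\<^sup>2)"
    by (simp add: norm_vec_def L2_set_def sum_nonneg)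
  then show ?thesis
    by (simp add: hdot_def complex_norm_square mult.commute del: of_real_power)
qed

lemma hdot_matrix_left: "hdot (A *v x) y = hdot x (cadj A *v y)"
  by (simp add: hdot_def matrix_vector_mult_def cadj_def sum_distrib_left sum_distrib_right mult_ac)
     (rule sum.swap)

lemma cadj_cadj [simp]: "cadj (cadj A) = A"
  by (simp add: cadj_def vec_eq_iff)

lemma hdot_matrix_right: "hdot x (A *v y) = hdot (cadj A *v x) y"
  by (simp add: hdot_matrix_left)

lemma cadj_mult: "cadj (A ** B) = cadj B ** cadj A"
  by (simp add: cadj_def matrix_matrix_mult_def vec_eq_iff mult.commute)

lemma cadj_mat_1 [simp]: "cadj (mat 1) = mat 1"
  by (auto simp: cadj_def mat_def vec_eq_iff)

lemma cadj_diff: "cadj (A - B) = cadj A - cadj B"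
  by (simp add: cadj_def vec_eq_iff)

lemma cadj_sum: "cadj (\<Sum>i\<in>S. g i) = (\<Sum>i\<in>S. cadj (g i))"
  by (simp add: cadj_def vec_eq_iff)

lemma hermitian_diff: "hermitian A \<Longrightarrow> hermitian B \<Longrightarrow> hermitian (A - B)"
  by (simp add: hermitian_def cadj_diff)

lemma continuous_on_hdot [continuous_intros]:
  assumes "continuous_on S g" "continuous_on S h"
  shows "continuous_on S (\<lambda>x. hdot (g x) (h x))"
  unfolding hdot_def using assms by (intro continuous_intros)

lemma continuous_on_matrix_vector [continuous_intros]:
  fixes A :: "complex^'n^'m"
  assumes "continuous_on S g"
  shows "continuous_on S (\<lambda>x. A *v g x)"
  unfolding matrix_vector_mult_def using assms by (intro continuous_intros)

section \<open>An orthonormal eigenbasis of a Hermitian matrix\<close>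

text \<open>Padding the conditions with zero rows, one of them row \<open>a\<close>, gives a square singular matrix.\<close>

lemma exists_orthogonal_vector:
  fixes f :: "'n::finite \<Rightarrow> complex^'n"
  assumes "a \<notin> S"
  shows "\<exists>x. x \<noteq> 0 \<and> (\<forall>i\<in>S. hdot (f i) x = 0)"
proof -
  define M :: "complex^'n^'n" where "M = (\<chi> i j. if i \<in> S then cnj (f i $ j) else 0)"
  have "row a M = 0"
    using assms by (simp add: M_def row_def vec_eq_iff)
  then have "det M = 0"
    by (rule det_zero_row)
  then have "\<not> (\<exists>B. B ** M = mat 1)"
    by (simp add: invertible_det_nz flip: invertible_left_inverse)
  then obtain x where x: "M *v x = 0" "x \<noteq> 0"
    by (auto simp: matrix_left_invertible_ker)
  have "hdot (f i) x = 0" if "i \<in> S" for i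
  proof -
    have "(M *v x) $ i = 0" using x by simp
    then show ?thesis using that by (simp add: M_def hdot_def matrix_vector_mult_def)
  qed
  with x show ?thesis by blast
qed

text \<open>Rayleigh's principle: a maximizer \<open>x\<close> of the quadratic form on the unit sphere of \<open>E\<close> is an
eigenvector, with the maximum \<open>d\<close> as eigenvalue. The first variation at \<open>x\<close> in the direction of the
defect \<open>w = X x - d x\<close>, which lies in \<open>E\<close> as well, is \<open>2 \<parallel>w\<parallel>\<^sup>2\<close>, so that \<open>w = 0\<close>.\<close>

lemma eigenvector_in_invariant_subspace:
  fixes X :: "complex^'n^'n"
  assumes X: "hermitian X"
    and closed: "closed E"
    and subspace: "\<And>x y c. x \<in> E \<Longrightarrow> y \<in> E \<Longrightarrow> x + c *s y \<in> E"
    and invariant: "\<And>x. x \<in> E \<Longrightarrow> X *v x \<in> E"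
    and ex: "x\<^sub>0 \<in> E" "x\<^sub>0 \<noteq> 0"
  shows "\<exists>x d::real. x \<in> E \<and> norm x = 1 \<and> X *v x = of_real d *s x"
proof -
  let ?q = "\<lambda>x. Re (hdot x (X *v x))"
  have zero: "0 \<in> E"
  proof -
    have "x\<^sub>0 + (-1) *s x\<^sub>0 = 0" by (simp add: vec_eq_iff)
    then show ?thesis using subspace[OF ex(1) ex(1), of "-1"] by simp
  qed
  have scale: "c *s x \<in> E" if "x \<in> E" for c x
    using subspace[OF zero that, of c] by simp
  have norm_scale: "norm (of_real r *s x) = \<bar>r\<bar> * norm x" for r and x :: "complex^'n"
  proof -
    have "of_real r *s x = r *\<^sub>R x"
      by (simp add: vec_eq_iff scaleR_conv_of_real[where 'a = complex])
    then show ?thesis by simp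
  qed
  have q_scale: "?q (of_real r *s x) = r\<^sup>2 * ?q x" for r x
    by (simp add: hdot_scale_left hdot_scale_right vector_scalar_commute power2_eq_square)
  have cont: "continuous_on (sphere 0 1 \<inter> E) ?q"
    by (intro continuous_intros)
  have "compact (sphere 0 1 \<inter> E)"
    using closed by (intro compact_Int_closed) auto
  moreover have "of_real (1 / norm x\<^sub>0) *s x\<^sub>0 \<in> sphere 0 1 \<inter> E"
    using ex scale norm_scale[of "1 / norm x\<^sub>0" x\<^sub>0] by simp
  ultimately obtain x where x: "x \<in> sphere 0 1 \<inter> E"
    and max: "\<And>y. y \<in> sphere 0 1 \<inter> E \<Longrightarrow> ?q y \<le> ?q x"
    using continuous_attains_sup[of "sphere 0 1 \<inter> E" ?q]
    using cont by blast
  define d where "d = ?q x"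
  have le: "?q y \<le> d * (norm y)\<^sup>2" if "y \<in> E" for y
  proof (cases "y = 0")
    case False
    let ?z = "of_real (1 / norm y) *s y"
    have "?q ?z \<le> d"
      unfolding d_def using that False scale norm_scale[of "1 / norm y" y] by (intro max) simp
    then show ?thesis
      using False by (simp only: q_scale) (simp add: field_simps)
  qed simp
  have nx: "norm x = 1" and xE: "x \<in> E"
    using x by auto
  define w where "w = X *v x - of_real d *s x"
  have wE: "w \<in> E"
  proof -
    have "w = X *v x + (- of_real d) *s x" by (simp add: w_def vec_eq_iff)
    then show ?thesis using subspace[OF invariant[OF xE] xE] by metis
  qed
  have Xx: "X *v x = w + of_real d *s x"
    by (simp add: w_def)
  have xw: "Re (hdot x w) = 0"
    by (simp add: w_def hdot_diff_right hdot_scale_right hdot_self nx flip: d_def)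
  then have wx: "Re (hdot w x) = 0"
    by (simp flip: cnj_hdot[of x w])
  \<comment> \<open>Compare the bound \<open>le\<close> at \<open>x + t w\<close> with the equality at \<open>x\<close>; what is left is of first order in \<open>t\<close> on the left and of second order on the right.\<close>
  have key: "2 * t * (norm w)\<^sup>2 \<le> t\<^sup>2 * (d * (norm w)\<^sup>2 - ?q w)" for t
  proof -
    let ?y = "x + of_real t *s w"
    have sym: "hdot x (X *v w) = cnj (hdot w (X *v x))"
      using X by (simp add: cnj_hdot hdot_matrix_left hermitian_def)
    have "?q ?y = d + 2 * t * (norm w)\<^sup>2 + t\<^sup>2 * ?q w"
      using wx
      by (simp add: matrix_vector_right_distrib hdot_add_left hdot_add_right hdot_scale_left
          hdot_scale_right vector_scalar_commute sym flip: d_def)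
        (simp add: Xx hdot_add_right hdot_scale_right hdot_self power2_eq_square algebra_simps)
    moreover have "(norm ?y)\<^sup>2 = 1 + t\<^sup>2 * (norm w)\<^sup>2"
    proof -
      have "(norm ?y)\<^sup>2 = Re (hdot ?y ?y)"
        by (simp add: hdot_self)
      also have "\<dots> = 1 + t\<^sup>2 * (norm w)\<^sup>2"
        using wx xw
        by (simp add: hdot_add_left hdot_add_right hdot_scale_left hdot_scale_right)
          (simp add: hdot_self nx power2_eq_square)
      finally show ?thesis .
    qed
    ultimately show ?thesis
      using le[OF subspace[OF xE wE, of "of_real t"]] by (simp add: algebra_simps)
  qed
  have "w = 0"
  proof (rule ccontr)
    assume "w \<noteq> 0"
    define N C where "N = (norm w)\<^sup>2" and "C = d * (norm w)\<^sup>2 - ?q w"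
    have N: "N > 0" using \<open>w \<noteq> 0\<close> by (simp add: N_def)
    have key: "2 * t * N \<le> t\<^sup>2 * C" for t
      using key[of t] by (simp add: N_def C_def)
    have "2 * N \<le> t * C" if "t > 0" for t
      using key[of t] that by (simp add: power2_eq_square)
    \<comment> \<open>This \<open>t\<close> is small enough for \<open>t C < N\<close>.\<close>
    from this[of "N / (\<bar>C\<bar> + 1)"] N have "2 * N \<le> N * (C / (\<bar>C\<bar> + 1))"
      by simp
    also have "\<dots> \<le> N * 1"
      using N by (intro mult_left_mono) (auto simp: field_simps)
    finally show False using N by simp
  qed
  then show ?thesis
    using Xx xE nx by auto
qed

definition orthonormal :: "('n::finite \<Rightarrow> complex^'n) \<Rightarrow> bool" where
  "orthonormal f \<longleftrightarrow> (\<forall>i j. hdot (f i) (f j) = (if i = j then 1 else 0))"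

text \<open>The eigenvectors are found one at a time: the orthogonal complement of those already found is
invariant, because \<open>X\<close> is Hermitian, and nonzero as long as fewer than \<open>n\<close> have been found. The induction
runs over the subsets of the index type, which avoids sequences and dimensions.\<close>

theorem hermitian_eigenbasis:
  fixes X :: "complex^'n^'n"
  assumes X: "hermitian X"
  shows "\<exists>f (d :: 'n \<Rightarrow> real). orthonormal f \<and> (\<forall>i. X *v f i = of_real (d i) *s f i)"
proof -
  have "\<exists>f (d :: 'n \<Rightarrow> real). (\<forall>i\<in>S. \<forall>j\<in>S. hdot (f i) (f j) = (if i = j then 1 else 0))
          \<and> (\<forall>i\<in>S. X *v f i = of_real (d i) *s f i)" (is "\<exists>f d. ?P S f d")
    if "finite S" for S :: "'n set"
    using that
  proof induction
    case (insert a S)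
    then obtain f d where fd: "?P S f d" by blast
    define E where "E = {x. \<forall>i\<in>S. hdot (f i) x = 0}"
    have "E = (\<Inter>i\<in>S. {x. hdot (f i) x = 0})"
      by (auto simp: E_def)
    moreover have "closed {x. hdot (f i) x = 0}" for i
      by (intro closed_Collect_eq continuous_intros)
    ultimately have "closed E"
      by auto
    moreover have "X *v x \<in> E" if "x \<in> E" for x
      using that X fd
      by (auto simp: E_def hdot_matrix_right hermitian_def hdot_scale_left)
    moreover have subspace: "x + c *s y \<in> E" if "x \<in> E" "y \<in> E" for x y c
      using that by (simp add: E_def hdot_add_right hdot_scale_right)
    moreover obtain x\<^sub>0 where "x\<^sub>0 \<in> E" "x\<^sub>0 \<noteq> 0"
      using exists_orthogonal_vector[OF insert.hyps(2), of f] by (auto simp: E_def)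
    ultimately obtain x e where x: "x \<in> E" "norm x = 1" "X *v x = of_real e *s x"
      using eigenvector_in_invariant_subspace[OF X, of E x\<^sub>0] subspace by metis
    have fx: "hdot (f i) x = 0" "hdot x (f i) = 0" if "i \<in> S" for i
      using x(1) that cnj_hdot[of "f i" x] by (auto simp: E_def)
    moreover have "hdot x x = 1"
      using x(2) by (simp add: hdot_self)
    ultimately have "?P (insert a S) (f(a := x)) (d(a := e))"
      using fd x(3) insert.hyps(2) by auto
    then show ?case by blast
  qed simp
  from this[of UNIV] show ?thesis
    by (auto simp: orthonormal_def)
qed

section \<open>The trace norm in terms of eigenvalues\<close>

definition columns_matrix :: "('n \<Rightarrow> complex^'n) \<Rightarrow> complex^'n^'n" where
  "columns_matrix f = (\<chi> a i. f i $ a)"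

lemma columns_matrix_unitary:
  assumes "orthonormal f"
  shows "cadj (columns_matrix f) ** columns_matrix f = mat 1"
    and "columns_matrix f ** cadj (columns_matrix f) = mat 1"
proof -
  show *: "cadj (columns_matrix f) ** columns_matrix f = mat 1"
    using assms
    by (simp add: orthonormal_def hdot_def columns_matrix_def cadj_def matrix_matrix_mult_def
        mat_def vec_eq_iff)
  then show "columns_matrix f ** cadj (columns_matrix f) = mat 1"
    by (simp add: matrix_left_right_inverse)
qed

lemma cadj_columns_matrix_vector: "cadj (columns_matrix f) *v x = (\<chi> i. hdot (f i) x)"
  by (simp add: columns_matrix_def cadj_def matrix_vector_mult_def hdot_def)

lemma parseval:
  assumes "orthonormal f"
  shows "hdot x y = (\<Sum>i\<in>UNIV. hdot x (f i) * hdot (f i) y)"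
proof -
  let ?U = "columns_matrix f"
  have "hdot x y = hdot x (?U *v (cadj ?U *v y))"
    using assms by (simp add: columns_matrix_unitary matrix_vector_mul_assoc)
  also have "\<dots> = hdot (cadj ?U *v x) (cadj ?U *v y)"
    by (simp add: hdot_matrix_right)
  finally show ?thesis
    by (simp add: cadj_columns_matrix_vector hdot_def[of "vec_lambda _"] cnj_hdot)
qed

lemma parseval_norm:
  assumes "orthonormal f"
  shows "(norm x)\<^sup>2 = (\<Sum>i\<in>UNIV. (cmod (hdot (f i) x))\<^sup>2)"
proof -
  have "complex_of_real ((norm x)\<^sup>2) = (\<Sum>i\<in>UNIV. hdot x (f i) * hdot (f i) x)"
    by (simp only: parseval[OF assms, of x x] flip: hdot_self)
  also have "\<dots> = of_real (\<Sum>i\<in>UNIV. (cmod (hdot (f i) x))\<^sup>2)"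
    by (simp add: complex_norm_square cnj_hdot mult.commute del: of_real_power)
  finally show ?thesis
    by (simp only: of_real_eq_iff)
qed

lemma orthonormal_norm:
  assumes "orthonormal f"
  shows "norm (f i) = 1"
  using assms hdot_self[of "f i"] by (simp add: orthonormal_def)
    (metis norm_ge_zero of_real_eq_1_iff of_real_power power2_eq_1_iff le_minus_one_simps(3))

lemma orthonormal_entry_le_1:
  assumes "orthonormal f"
  shows "cmod (f i $ a) \<le> 1"
  using Finite_Cartesian_Product.norm_nth_le[of "f i" a] orthonormal_norm[OF assms] by simp

lemma trace_orthonormal:
  assumes "orthonormal f"
  shows "trace A = (\<Sum>i\<in>UNIV. hdot (f i) (A *v f i))"
proof -
  let ?U = "columns_matrix f"
  have "trace A = trace (A ** ?U ** cadj ?U)"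
    using assms by (simp add: columns_matrix_unitary flip: matrix_mul_assoc)
  also have "\<dots> = trace (cadj ?U ** (A ** ?U))"
    by (rule trace_mul_sym)
  also have "\<dots> = (\<Sum>i\<in>UNIV. hdot (f i) (A *v f i))"
    by (simp add: trace_def columns_matrix_def hdot_def cadj_def matrix_matrix_mult_def
        matrix_vector_mult_def)
  finally show ?thesis .
qed

lemma columns_matrix_eigen:
  assumes "\<And>i. X *v f i = c i *s f i"
  shows "(\<Sum>k\<in>UNIV. X $ a $ k * columns_matrix f $ k $ b) = columns_matrix f $ a $ b * c b"
proof -
  have "(X *v f b) $ a = (c b *s f b) $ a"
    using assms by simp
  then show ?thesis
    by (simp add: matrix_vector_mult_def columns_matrix_def mult.commute)
qed

lemma entry_eigenbasis:
  assumes "orthonormal f" "\<And>i. X *v f i = c i *s f i"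
  shows "X $ a $ b = (\<Sum>i\<in>UNIV. c i * f i $ a * cnj (f i $ b))"
proof -
  let ?U = "columns_matrix f"
  have "X = (X ** ?U) ** cadj ?U"
    using assms(1) by (simp add: columns_matrix_unitary flip: matrix_mul_assoc)
  then have "X $ a $ b = ((X ** ?U) ** cadj ?U) $ a $ b"
    by simp
  also have "\<dots> = (\<Sum>i\<in>UNIV. (\<Sum>k\<in>UNIV. X $ a $ k * ?U $ k $ i) * cnj (?U $ b $ i))"
    by (simp add: matrix_matrix_mult_def cadj_def)
  also have "\<dots> = (\<Sum>i\<in>UNIV. c i * f i $ a * cnj (f i $ b))"
    by (simp only: columns_matrix_eigen[OF assms(2)]) (simp add: columns_matrix_def mult_ac)
  finally show ?thesis .
qed

lemma const_poly_sum: "[:\<Sum>i\<in>S. g i:] = (\<Sum>i\<in>S. [:g i:])"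
  by (induction S rule: infinite_finite_induct) (simp_all, metis add_pCons add_0)

text \<open>With \<open>U\<close> the matrix of the eigenvectors and \<open>D\<close> the diagonal matrix of the eigenvalues,
\<open>X U = U D\<close> gives \<open>(t I - X) U = U (t I - D)\<close> over the polynomials in \<open>t\<close>. Take determinants and cancel
the one of \<open>U\<close>.\<close>

lemma charpoly_eigenbasis:
  fixes X :: "complex^'n^'n"
  assumes f: "orthonormal f" and eig: "\<And>i. X *v f i = c i *s f i"
  shows "charpoly X = (\<Prod>i\<in>UNIV. [:- c i, 1:])"
proof -
  let ?U = "columns_matrix f"
  \<comment> \<open>\<open>C\<close> regards a complex matrix as a matrix of constant polynomials.\<close>
  define C :: "complex^'n^'n \<Rightarrow> complex poly^'n^'n" where "C A = (\<chi> i j. [:A $ i $ j:])" for A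
  define M where "M = (\<chi> i j. (if i = j then [:0, 1:] else 0) - [:X $ i $ j:])"
  define D :: "complex poly^'n^'n" where "D = (\<chi> i j. if i = j then [:- c i, 1:] else 0)"
  have C_mult: "C (A ** B) = C A ** C B" for A B
    by (simp add: C_def matrix_matrix_mult_def vec_eq_iff const_poly_sum mult.commute)
  have "C (cadj ?U) ** C ?U = C (mat 1)"
    using f by (simp add: columns_matrix_unitary flip: C_mult)
  also have "C (mat 1) = mat 1"
    by (simp add: C_def mat_def vec_eq_iff)
  finally have "det (C (cadj ?U)) * det (C ?U) = 1"
    by (metis det_I det_mul)
  then have nz: "det (C ?U) \<noteq> 0"
    by auto
  have "M ** C ?U = C ?U ** D"
  proof -
    have "(M ** C ?U) $ a $ b = (C ?U ** D) $ a $ b" for a b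
    proof -
      have "(M ** C ?U) $ a $ b
          = (\<Sum>k\<in>UNIV. (if a = k then [:0, 1:] * [:?U $ k $ b:] else 0) - [:X $ a $ k * ?U $ k $ b:])"
        by (simp only: matrix_matrix_mult_def M_def C_def vec_lambda_beta)
          (intro sum.cong refl, simp add: left_diff_distrib)
      also have "\<dots> = [:0, 1:] * [:?U $ a $ b:] - [:\<Sum>k\<in>UNIV. X $ a $ k * ?U $ k $ b:]"
        by (simp only: sum_subtractf const_poly_sum) simp
      also have "\<dots> = [:?U $ a $ b:] * [:- c b, 1:]"
        by (simp only: columns_matrix_eigen[OF eig]) simp
      also have "\<dots> = (\<Sum>k\<in>UNIV. if k = b then [:?U $ a $ k:] * [:- c k, 1:] else 0)"
        by (simp only: sum.delta finite UNIV_I if_True)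
      also have "\<dots> = (C ?U ** D) $ a $ b"
        by (simp only: matrix_matrix_mult_def D_def C_def vec_lambda_beta)
          (intro sum.cong refl, simp)
      finally show ?thesis .
    qed
    then show ?thesis by (simp add: vec_eq_iff)
  qed
  then have "det M * det (C ?U) = det (C ?U) * det D"
    by (metis det_mul)
  with nz have "det M = det D"
    by simp
  also have "\<dots> = (\<Prod>i\<in>UNIV. D $ i $ i)"
    by (rule det_diagonal) (simp add: D_def)
  finally show ?thesis
    by (simp add: charpoly_def M_def D_def)
qed

lemma trace_norm_eigenbasis:
  assumes "orthonormal f" "\<And>i. X *v f i = of_real (d i) *s f i"
  shows "trace_norm X = (\<Sum>i\<in>UNIV. \<bar>d i\<bar>)"
proof -
  have "proots (charpoly X) = (\<Sum>i\<in>UNIV. {#complex_of_real (d i)#})"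
    by (subst charpoly_eigenbasis[OF assms]) (simp add: proots_prod)
  then show ?thesis
    by (simp add: trace_norm_def sum_unfold_sum_mset image_mset.compositionality comp_def)
qed

lemma trace_norm_nonneg: "hermitian X \<Longrightarrow> 0 \<le> trace_norm X"
  using hermitian_eigenbasis[of X] trace_norm_eigenbasis[of _ X] by (metis abs_ge_zero sum_nonneg)

lemma entry_le_trace_norm:
  assumes "hermitian X"
  shows "cmod (X $ a $ b) \<le> trace_norm X"
proof -
  obtain f d where f: "orthonormal f" and d: "\<And>i. X *v f i = of_real (d i) *s f i"
    using hermitian_eigenbasis[OF assms] by blast
  have "cmod (X $ a $ b) \<le> (\<Sum>i\<in>UNIV. cmod (of_real (d i) * f i $ a * cnj (f i $ b)))"
    unfolding entry_eigenbasis[OF f d] by (rule norm_sum)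
  also have "\<dots> \<le> (\<Sum>i\<in>UNIV. \<bar>d i\<bar>)"
  proof (rule sum_mono)
    fix i
    have "\<bar>d i\<bar> * cmod (f i $ a) * cmod (f i $ b) \<le> \<bar>d i\<bar> * 1 * 1"
      by (intro mult_mono orthonormal_entry_le_1[OF f]) auto
    then show "cmod (of_real (d i) * f i $ a * cnj (f i $ b)) \<le> \<bar>d i\<bar>"
      by (simp add: norm_mult)
  qed
  finally show ?thesis
    by (simp add: trace_norm_eigenbasis[OF f d])
qed

lemma norm_le_trace_norm:
  fixes X :: "complex^'n^'n"
  assumes "hermitian X"
  shows "norm X \<le> real (CARD('n)\<^sup>2) * trace_norm X"
proof -
  have "norm X \<le> (\<Sum>a\<in>UNIV. norm (X $ a))"
    by (simp add: norm_vec_def L2_set_le_sum)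
  also have "\<dots> \<le> (\<Sum>a\<in>(UNIV::'n set). \<Sum>b\<in>(UNIV::'n set). trace_norm X)"
  proof (rule sum_mono)
    fix a
    have "norm (X $ a) \<le> (\<Sum>b\<in>UNIV. cmod (X $ a $ b))"
      by (simp add: norm_vec_def L2_set_le_sum)
    also have "\<dots> \<le> (\<Sum>b\<in>(UNIV::'n set). trace_norm X)"
      by (intro sum_mono entry_le_trace_norm assms)
    finally show "norm (X $ a) \<le> (\<Sum>b\<in>(UNIV::'n set). trace_norm X)" .
  qed
  finally show ?thesis
    by (simp add: power2_eq_square)
qed

section \<open>Density matrices\<close>

lemma psd_hdot: "psd A \<longleftrightarrow> hermitian A \<and> (\<forall>x. 0 \<le> Re (hdot x (A *v x)))"
  by (simp add: psd_def hdot_def)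

lemma density_hermitian: "A \<in> density_matrices \<Longrightarrow> hermitian A"
  by (simp add: density_matrices_def psd_def)

lemma density_diagonal:
  assumes "A \<in> density_matrices" "orthonormal f"
  shows "0 \<le> Re (hdot x (A *v x))" "(\<Sum>i\<in>UNIV. Re (hdot (f i) (A *v f i))) = 1"
proof -
  show "0 \<le> Re (hdot x (A *v x))"
    using assms by (simp add: density_matrices_def psd_hdot)
  have "(\<Sum>i\<in>UNIV. hdot (f i) (A *v f i)) = 1"
    using assms trace_orthonormal[OF assms(2), of A] by (simp add: density_matrices_def)
  then show "(\<Sum>i\<in>UNIV. Re (hdot (f i) (A *v f i))) = 1"
    by (simp flip: Re_sum)
qed

lemma eigenvalue_hdot:
  assumes "orthonormal f" "X *v f i = of_real d *s f i"
  shows "d = Re (hdot (f i) (X *v f i))"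
  using assms by (simp add: hdot_scale_right orthonormal_def)

lemma trace_norm_density:
  assumes "A \<in> density_matrices"
  shows "trace_norm A = 1"
proof -
  obtain f d where f: "orthonormal f" and d: "\<And>i. A *v f i = of_real (d i) *s f i"
    using hermitian_eigenbasis[OF density_hermitian[OF assms]] by blast
  have "\<bar>d i\<bar> = Re (hdot (f i) (A *v f i))" for i
    using density_diagonal(1)[OF assms f, of "f i"] eigenvalue_hdot[OF f d, of i] by simp
  then show ?thesis
    using density_diagonal(2)[OF assms f] by (simp add: trace_norm_eigenbasis[OF f d])
qed

text \<open>Each eigenvalue of the difference is a difference of two nonnegative diagonal entries, and both
diagonals sum to \<open>1\<close>.\<close>

lemma trace_norm_density_diff_le:
  assumes A: "A \<in> density_matrices" and B: "B \<in> density_matrices"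
  shows "trace_norm (A - B) \<le> 2"
proof -
  obtain f d where f: "orthonormal f" and d: "\<And>i. (A - B) *v f i = of_real (d i) *s f i"
    using hermitian_eigenbasis[OF hermitian_diff] density_hermitian A B by blast
  have "\<bar>d i\<bar> \<le> Re (hdot (f i) (A *v f i)) + Re (hdot (f i) (B *v f i))" for i
    using density_diagonal(1)[OF A f, of "f i"] density_diagonal(1)[OF B f, of "f i"]
      eigenvalue_hdot[OF f d, of i]
    by (simp add: matrix_vector_mult_diff_rdistrib hdot_diff_right)
  then have "trace_norm (A - B)
      \<le> (\<Sum>i\<in>UNIV. Re (hdot (f i) (A *v f i)) + Re (hdot (f i) (B *v f i)))"
    unfolding trace_norm_eigenbasis[OF f d] by (intro sum_mono) 
  then show ?thesis
    by (simp add: sum.distrib density_diagonal(2)[OF A f] density_diagonal(2)[OF B f])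
qed

text \<open>Boundedness holds because the trace norm is \<open>1\<close> on density matrices and dominates the norm up to a constant.\<close>

lemma compact_density_matrices: "compact (density_matrices :: (complex^'n^'n) set)"
  unfolding compact_eq_bounded_closed
proof
  have "norm A \<le> real (CARD('n)\<^sup>2)" if "A \<in> density_matrices" for A :: "complex^'n^'n"
    using norm_le_trace_norm[OF density_hermitian[OF that]] trace_norm_density[OF that] by simp
  then show "bounded (density_matrices :: (complex^'n^'n) set)"
    by (auto simp: bounded_iff)
  have "density_matrices = (\<Inter>i j. {A::complex^'n^'n. cnj (A $ j $ i) = A $ i $ j})
      \<inter> (\<Inter>x. {A. 0 \<le> Re (\<Sum>i\<in>UNIV. cnj (x $ i) * (\<Sum>j\<in>UNIV. A $ i $ j * x $ j))})
      \<inter> {A. (\<Sum>i\<in>UNIV. A $ i $ i) = 1}"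
    by (auto simp: density_matrices_def psd_def hermitian_def cadj_def vec_eq_iff
        matrix_vector_mult_def trace_def)
  also have "closed \<dots>"
    by (intro closed_Int closed_INT ballI closed_Collect_eq closed_Collect_le continuous_intros)
  finally show "closed (density_matrices :: (complex^'n^'n) set)" .
qed

lemma convex_density_matrices: "convex (density_matrices :: (complex^'n^'n) set)"
proof (rule convexI)
  fix A B :: "complex^'n^'n" and u v :: real
  assume A: "A \<in> density_matrices" and B: "B \<in> density_matrices"
    and uv: "0 \<le> u" "0 \<le> v" "u + v = 1"
  have "hermitian (u *\<^sub>R A + v *\<^sub>R B)"
    using density_hermitian[OF A] density_hermitian[OF B]
    by (simp add: hermitian_def cadj_def vec_eq_iff)
  moreover have "Re (hdot x ((u *\<^sub>R A + v *\<^sub>R B) *v x))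
      = u * Re (hdot x (A *v x)) + v * Re (hdot x (B *v x))" for x
    by (simp add: hdot_def matrix_vector_mult_def algebra_simps sum.distrib sum_distrib_left
        scaleR_conv_of_real[where 'a = complex])
  moreover have "trace (u *\<^sub>R A + v *\<^sub>R B) = of_real u * trace A + of_real v * trace B"
    by (simp add: trace_def sum.distrib sum_distrib_left scaleR_conv_of_real[where 'a = complex])
  ultimately show "u *\<^sub>R A + v *\<^sub>R B \<in> density_matrices"
    using A B uv by (auto simp: density_matrices_def psd_hdot simp flip: of_real_add)
qed

lemma outer_matrix_vector: "outer x y *v z = hdot y z *s x"
  by (simp add: outer_def matrix_vector_mult_def hdot_def vec_eq_iff sum_distrib_left mult_ac)

lemma trace_outer: "trace (outer x y) = hdot y x"
  by (simp add: trace_def outer_def hdot_def mult.commute)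

lemma cadj_outer: "cadj (outer x y) = outer y x"
  by (simp add: cadj_def outer_def vec_eq_iff mult.commute)

lemma outer_density:
  assumes "norm x = 1"
  shows "outer x x \<in> density_matrices"
proof -
  have "0 \<le> Re (hdot y (outer x x *v y))" for y
  proof -
    have "hdot y (outer x x *v y) = hdot x y * cnj (hdot x y)"
      by (simp add: outer_matrix_vector hdot_scale_right cnj_hdot)
    then show ?thesis
      by (simp flip: complex_norm_square)
  qed
  then show ?thesis
    using assms by (simp add: density_matrices_def psd_hdot hermitian_def cadj_outer trace_outer hdot_self)
qed

lemma density_matrices_nonempty: "(density_matrices :: (complex^'n^'n) set) \<noteq> {}"
proof -
  have "norm (axis undefined 1 :: complex^'n) = 1"
    by (simp add: norm_axis_1)
  then show ?thesis
    using outer_density by blast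
qed

section \<open>Kraus maps\<close>

lemma sum_matrix_mult_left: "(\<Sum>i\<in>S. g i) ** B = (\<Sum>i\<in>S. g i ** (B :: complex^'n^'n))"
  by (simp add: matrix_matrix_mult_def vec_eq_iff sum_distrib_right) (intro allI, rule sum.swap)

lemma sum_matrix_mult_right: "(A :: complex^'n^'n) ** (\<Sum>i\<in>S. g i) = (\<Sum>i\<in>S. A ** g i)"
  by (simp add: matrix_matrix_mult_def vec_eq_iff sum_distrib_left) (intro allI, rule sum.swap)

lemma sum_matrix_vector: "(\<Sum>i\<in>S. g i) *v x = (\<Sum>i\<in>S. g i *v (x :: complex^'n))"
  by (simp add: matrix_vector_mult_def vec_eq_iff sum_distrib_right) (intro allI, rule sum.swap)

lemma trace_sum: "trace (\<Sum>i\<in>S. g i :: complex^'n^'n) = (\<Sum>i\<in>S. trace (g i))"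
  by (simp add: trace_def) (rule sum.swap)

lemma sandwich_diff: "A ** (X - Y) ** B = A ** X ** B - A ** Y ** (B :: complex^'n^'n)"
  by (simp add: matrix_matrix_mult_def vec_eq_iff algebra_simps sum_subtractf)

lemma hermitian_sandwich: "hermitian X \<Longrightarrow> hermitian (\<Sum>w\<in>I. W w ** X ** cadj (W w))"
  by (simp add: hermitian_def cadj_sum cadj_mult matrix_mul_assoc)

lemma hdot_sandwich: "hdot x ((A ** X ** cadj A) *v x) = hdot (cadj A *v x) (X *v (cadj A *v x))"
  by (simp add: hdot_matrix_left matrix_vector_mul_assoc matrix_mul_assoc)

lemma trace_sandwich_sum:
  fixes X :: "complex^'n^'n"
  assumes "(\<Sum>w\<in>I. cadj (W w) ** W w) = mat 1"
  shows "trace (\<Sum>w\<in>I. W w ** X ** cadj (W w)) = trace X"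
proof -
  have "trace (\<Sum>w\<in>I. W w ** X ** cadj (W w)) = (\<Sum>w\<in>I. trace (cadj (W w) ** W w ** X))"
    unfolding trace_sum
    by (simp only: trace_mul_sym[of "W _ ** X" "cadj (W _)"] matrix_mul_assoc)
  also have "\<dots> = trace X"
    using assms by (simp flip: trace_sum sum_matrix_mult_left)
  finally show ?thesis .
qed

lemma kraus_map_density:
  assumes "(\<Sum>i=1..m. cadj (V i) ** V i) = mat 1" "X \<in> density_matrices"
  shows "kraus_map m V X \<in> density_matrices"
proof -
  have "0 \<le> Re (hdot x (kraus_map m V X *v x))" for x
    using assms(2)
    by (simp add: kraus_map_def sum_matrix_vector hdot_sum_right hdot_sandwich
        density_matrices_def psd_hdot sum_nonneg)
  then show ?thesis
    using assms trace_sandwich_sum[OF assms(1), of X] hermitian_sandwich[OF density_hermitian[OF assms(2)]]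
    by (simp add: density_matrices_def psd_hdot kraus_map_def)
qed

lemma kraus_iterate_density:
  assumes "(\<Sum>i=1..m. cadj (V i) ** V i) = mat 1" "X \<in> density_matrices"
  shows "(kraus_map m V ^^ k) X \<in> density_matrices"
proof (induction k)
  case (Suc k)
  then show ?case
    using kraus_map_density[OF assms(1)] by simp
qed (simp add: assms)

lemma continuous_on_kraus_map: "continuous_on S (kraus_map m V)"
  unfolding kraus_map_def matrix_matrix_mult_def by (intro continuous_intros)

section \<open>Words in the Kraus operators\<close>

definition words :: "nat \<Rightarrow> nat \<Rightarrow> nat list set" where
  "words m k = {w. set w \<subseteq> {1..m} \<and> length w = k}"

text \<open>The head of the list is the factor applied first. With this order the recursion of
\<^const>\<open>kraus_space\<close>, which puts the new factors \<open>V\<^sub>i\<^sup>*\<close> and \<open>V\<^sub>j\<close> on the outside of \<open>W\<^sub>a\<^sup>* W\<^sub>b\<close>, prepends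
letters to the two words.\<close>

primrec kraus_word :: "(nat \<Rightarrow> complex^'n^'n) \<Rightarrow> nat list \<Rightarrow> complex^'n^'n" where
  "kraus_word V [] = mat 1"
| "kraus_word V (i # w) = kraus_word V w ** V i"

lemma words_0 [simp]: "words m 0 = {[]}"
  by (auto simp: words_def)

lemma words_Suc: "words m (Suc k) = (\<lambda>(i, w). i # w) ` ({1..m} \<times> words m k)"
  by (auto simp: words_def length_Suc_conv image_iff)

lemma finite_words [simp]: "finite (words m k)"
  by (simp add: words_def finite_lists_length_eq)

lemma sum_words_Suc: "(\<Sum>w\<in>words m (Suc k). g w) = (\<Sum>i=1..m. \<Sum>w\<in>words m k. g (i # w))"
  unfolding words_Suc
  by (subst sum.reindex) (auto simp: inj_on_def sum.cartesian_product split_def)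

lemma kraus_iterate:
  "(kraus_map m V ^^ k) X = (\<Sum>w\<in>words m k. kraus_word V w ** X ** cadj (kraus_word V w))"
proof (induction k arbitrary: X)
  case (Suc k)
  have "(kraus_map m V ^^ Suc k) X = (kraus_map m V ^^ k) (kraus_map m V X)"
    by (simp add: funpow_swap1)
  also have "\<dots> = (\<Sum>w\<in>words m k. \<Sum>i=1..m.
      kraus_word V (i # w) ** X ** cadj (kraus_word V (i # w)))"
    by (simp add: Suc kraus_map_def sum_matrix_mult_left sum_matrix_mult_right cadj_mult matrix_mul_assoc)
  also have "\<dots> = (\<Sum>i=1..m. \<Sum>w\<in>words m k.
      kraus_word V (i # w) ** X ** cadj (kraus_word V (i # w)))"
    by (rule sum.swap)
  finally show ?case
    by (simp only: sum_words_Suc)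
qed simp

lemma kraus_word_isometry:
  assumes "(\<Sum>i=1..m. cadj (V i) ** V i) = mat 1"
  shows "(\<Sum>w\<in>words m k. cadj (kraus_word V w) ** kraus_word V w) = mat 1"
proof (induction k)
  case (Suc k)
  have "(\<Sum>w\<in>words m (Suc k). cadj (kraus_word V w) ** kraus_word V w)
      = (\<Sum>i=1..m. cadj (V i) ** (\<Sum>w\<in>words m k. cadj (kraus_word V w) ** kraus_word V w) ** V i)"
    by (simp add: sum_words_Suc sum_matrix_mult_left sum_matrix_mult_right cadj_mult matrix_mul_assoc)
  then show ?case
    using assms by (simp add: Suc)
qed simp

section \<open>The spaces spanned by products of words\<close>

lemma matrix_mult_cscale:
  "A ** cscale c X = cscale c (A ** X)" "cscale c X ** A = cscale c (X ** (A :: complex^'n^'n))"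
  by (simp_all add: cscale_def matrix_matrix_mult_def vec_eq_iff sum_distrib_left mult_ac)

lemma sandwich_add: "A ** (X + Y) ** B = A ** X ** B + A ** Y ** (B :: complex^'n^'n)"
  by (simp add: matrix_matrix_mult_def vec_eq_iff algebra_simps sum.distrib)

lemma span_sandwich:
  fixes A B :: "complex^'n^'n"
  assumes "X \<in> cmat.span S" "\<And>Y. Y \<in> S \<Longrightarrow> A ** Y ** B \<in> cmat.span T"
  shows "A ** X ** B \<in> cmat.span T"
  using assms(1)
proof (induction rule: cmat.span_induct_alt)
  case base
  then show ?case by (simp add: cmat.span_zero)
next
  case (step c x y)
  then show ?case
    by (simp add: sandwich_add matrix_mult_cscale assms(2)
        cmat.span_add cmat.span_scale)
qed

lemma kraus_space_words:
  "kraus_space m V k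
    = cmat.span {cadj (kraus_word V a) ** kraus_word V b | a b. a \<in> words m k \<and> b \<in> words m k}"
  (is "_ = cmat.span (?S k)")
proof (induction k)
  case (Suc k)
  have "kraus_space m V (Suc k) \<subseteq> cmat.span (?S (Suc k))"
    unfolding kraus_space.simps
  proof (rule cmat.span_minimal[OF _ cmat.subspace_span], clarify)
    fix X i j
    assume X: "X \<in> kraus_space m V k" and ij: "i \<in> {1..m}" "j \<in> {1..m}"
    have "cadj (V i) ** Y ** V j \<in> cmat.span (?S (Suc k))" if Y: "Y \<in> ?S k" for Y
    proof -
      obtain a b where ab: "a \<in> words m k" "b \<in> words m k"
        "Y = cadj (kraus_word V a) ** kraus_word V b"
        using Y by blast
      have "cadj (V i) ** Y ** V j = cadj (kraus_word V (i # a)) ** kraus_word V (j # b)"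
        by (simp add: ab cadj_mult matrix_mul_assoc)
      then show ?thesis
        using ab ij by (intro cmat.span_base) (force simp: words_Suc)
    qed
    then show "cadj (V i) ** X ** V j \<in> cmat.span (?S (Suc k))"
      using X by (intro span_sandwich[of X "?S k"]) (simp_all add: Suc)
  qed
  moreover have "?S (Suc k) \<subseteq> {cadj (V i) ** X ** V j | X i j.
      X \<in> kraus_space m V k \<and> i \<in> {1..m} \<and> j \<in> {1..m}}"
  proof clarify
    fix a b
    assume "a \<in> words m (Suc k)" "b \<in> words m (Suc k)"
    then obtain i a' j b' where "a = i # a'" "b = j # b'" "i \<in> {1..m}" "j \<in> {1..m}"
      "a' \<in> words m k" "b' \<in> words m k"
      by (auto simp: words_Suc)
    moreover from this have "cadj (kraus_word V a') ** kraus_word V b' \<in> kraus_space m V k"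
      unfolding Suc by (intro cmat.span_base) blast
    moreover from calculation have "cadj (kraus_word V a) ** kraus_word V b
        = cadj (V i) ** (cadj (kraus_word V a') ** kraus_word V b') ** V j"
      by (simp add: cadj_mult matrix_mul_assoc)
    ultimately show "\<exists>X i j. cadj (kraus_word V a) ** kraus_word V b = cadj (V i) ** X ** V j \<and>
        X \<in> kraus_space m V k \<and> i \<in> {1..m} \<and> j \<in> {1..m}"
      by blast
  qed
  then have "cmat.span (?S (Suc k)) \<subseteq> kraus_space m V (Suc k)"
    unfolding kraus_space.simps by (rule cmat.span_mono)
  ultimately show ?case
    by (rule subset_antisym)
qed simp

lemma trace_outer_mult: "trace (outer x y ** B) = hdot y (B *v x)"
proof -
  have "trace (outer x y ** B) = trace (B ** outer x y)"
    by (rule trace_mul_sym)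
  also have "\<dots> = hdot y (B *v x)"
    by (simp add: trace_def hdot_def matrix_matrix_mult_def matrix_vector_mult_def outer_def
        sum_distrib_left sum_distrib_right mult_ac)
  finally show ?thesis .
qed

text \<open>The inner product of \<open>x y\<^sup>*\<close> with \<open>B\<close> is \<open>x\<^sup>* B y\<close>, which is \<open>\<langle>W\<^sub>a x, W\<^sub>b y\<rangle>\<close> for \<open>B = W\<^sub>a\<^sup>* W\<^sub>b\<close>;
these \<open>B\<close> span the space.\<close>

lemma outer_orthogonal_kraus_space:
  "outer x y \<in> orth_compl (kraus_space m V k) \<longleftrightarrow>
    (\<forall>a\<in>words m k. \<forall>b\<in>words m k. hdot (kraus_word V a *v x) (kraus_word V b *v y) = 0)"
proof
  assume "outer x y \<in> orth_compl (kraus_space m V k)"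
  then have *: "hdot x (B *v y) = 0" if "B \<in> kraus_space m V k" for B
    using that by (simp add: orth_compl_def cadj_outer trace_outer_mult)
  show "\<forall>a\<in>words m k. \<forall>b\<in>words m k. hdot (kraus_word V a *v x) (kraus_word V b *v y) = 0"
  proof (intro ballI)
    fix a b assume "a \<in> words m k" "b \<in> words m k"
    then have "cadj (kraus_word V a) ** kraus_word V b \<in> kraus_space m V k"
      unfolding kraus_space_words by (intro cmat.span_base) blast
    from *[OF this] show "hdot (kraus_word V a *v x) (kraus_word V b *v y) = 0"
      by (simp add: hdot_matrix_left matrix_vector_mul_assoc)
  qed
next
  assume *: "\<forall>a\<in>words m k. \<forall>b\<in>words m k. hdot (kraus_word V a *v x) (kraus_word V b *v y) = 0"
  have "hdot x (B *v y) = 0" if "B \<in> kraus_space m V k" for B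
    using that unfolding kraus_space_words
  proof (induction rule: cmat.span_induct_alt)
    case (step c A B)
    have "cscale c A *v y = c *s (A *v y)"
      by (simp add: cscale_def matrix_vector_mult_def vec_eq_iff sum_distrib_left mult_ac)
    moreover have "hdot x (A *v y) = 0"
      using step(1) * by (auto simp: hdot_matrix_left simp flip: matrix_vector_mul_assoc)
    ultimately show ?case
      using step by (simp add: matrix_vector_mult_add_rdistrib hdot_add_right hdot_scale_right)
  qed simp
  then show "outer x y \<in> orth_compl (kraus_space m V k)"
    by (simp add: orth_compl_def cadj_outer trace_outer_mult)
qed

section \<open>Matrices of rank one\<close>

lemma rank_1_iff_outer:
  "rank (A :: complex^'n^'n) = 1 \<longleftrightarrow> (\<exists>x y. x \<noteq> 0 \<and> y \<noteq> 0 \<and> A = outer x y)"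
proof
  assume "rank A = 1"
  then have "vec.dim (rows A) = 1"
    by (simp add: row_rank_def_gen)
  then obtain B where B: "B \<subseteq> rows A" "vec.independent B" "rows A \<subseteq> vec.span B" "card B = 1"
    using vec.basis_exists[of "rows A"] by metis
  from B(4) obtain b where [simp]: "B = {b}"
    by (auto simp: card_1_singleton_iff)
  have b: "b \<noteq> 0"
    using B(2) vec.dependent_zero by auto
  have "\<exists>c. A $ i = c *s b" for i
  proof -
    have "A $ i \<in> rows A"
      by (auto simp: rows_def row_def vec_nth_inverse)
    then show ?thesis
      using B(3) by (auto simp: vec.span_singleton)
  qed
  then obtain c where c: "\<And>i. A $ i = c i *s b"
    by metis
  have "A = outer (\<chi> i. c i) (\<chi> i. cnj (b $ i))"
    by (simp add: outer_def vec_eq_iff c)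
  moreover have "(\<chi> i. c i) \<noteq> 0"
  proof
    assume "(\<chi> i. c i) = 0"
    then have "c i = 0" for i
      by (metis vec_lambda_beta zero_index)
    then have "A = 0"
      by (simp add: vec_eq_iff c)
    then show False
      using B(1) b by (auto simp: rows_def row_def vec_eq_iff)
  qed
  moreover have "(\<chi> i. cnj (b $ i)) \<noteq> 0"
    using b by (simp add: vec_eq_iff)
  ultimately show "\<exists>x y. x \<noteq> 0 \<and> y \<noteq> 0 \<and> A = outer x y"
    by blast
next
  assume "\<exists>x y. x \<noteq> 0 \<and> y \<noteq> 0 \<and> A = outer x y"
  then obtain x y where xy: "x \<noteq> 0" "y \<noteq> 0" and A: "A = outer x y"
    by blast
  define b where "b = (\<chi> j. cnj (y $ j))"
  have b: "b \<noteq> 0"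
    using xy by (simp add: b_def vec_eq_iff)
  have row: "row i A = x $ i *s b" for i
    by (simp add: A row_def outer_def b_def vec_eq_iff)
  obtain i where i: "x $ i \<noteq> 0"
    using xy by (auto simp: vec_eq_iff)
  have "vec.dim (rows A) = 1"
  proof (rule vec.dim_unique[of "{x $ i *s b}"])
    show "{x $ i *s b} \<subseteq> rows A"
      by (auto simp: rows_def row)
    show "rows A \<subseteq> vec.span {x $ i *s b}"
    proof
      fix r assume "r \<in> rows A"
      then obtain j where "r = (x $ j / x $ i) *s (x $ i *s b)"
        using i by (auto simp: rows_def row)
      then show "r \<in> vec.span {x $ i *s b}"
        unfolding vec.span_singleton by blast
    qed
    have "x $ i *s b \<noteq> 0"
      using i b by (simp add: vec_eq_iff)
    then show "vec.independent {x $ i *s b}"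
      by simp
  qed simp
  then show "rank A = 1"
    by (simp add: row_rank_def_gen)
qed

section \<open>Stabilization of the increasing spaces\<close>

text \<open>The identity is the sum of the \<open>V\<^sub>i\<^sup>* V\<^sub>i\<close>, so the inclusion holds at the start, and the recursion
preserves it.\<close>

lemma kraus_space_mono:
  assumes "(\<Sum>i=1..m. cadj (V i) ** V i) = mat 1"
  shows "kraus_space m V k \<subseteq> kraus_space m V (Suc k)"
proof (induction k)
  case 0
  have "(\<Sum>i=1..m. cadj (V i) ** mat 1 ** V i) \<in> kraus_space m V (Suc 0)"
    unfolding kraus_space.simps
    by (intro cmat.span_sum cmat.span_base CollectI exI conjI) (auto simp: cmat.span_base)
  then have "mat 1 \<in> kraus_space m V (Suc 0)"
    using assms by (simp del: kraus_space.simps(2))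
  then show ?case
    unfolding kraus_space.simps by (intro cmat.span_minimal[OF _ cmat.subspace_span]) simp
next
  case (Suc k)
  then show ?case
    unfolding kraus_space.simps(2) by (intro cmat.span_mono) blast
qed

text \<open>The matrix units span.\<close>

lemma independent_card_le:
  fixes B :: "(complex^'n^'n) set"
  assumes "cmat.independent B"
  shows "card B \<le> CARD('n)\<^sup>2"
proof -
  define E :: "'n \<times> 'n \<Rightarrow> complex^'n^'n" where
    "E = (\<lambda>(a, b). \<chi> i j. if i = a \<and> j = b then 1 else 0)"
  have "A \<in> cmat.span (range E)" for A
  proof -
    have "(\<Sum>a\<in>UNIV. \<Sum>b\<in>UNIV. cscale (A $ a $ b) (E (a, b))) $ i $ j = A $ i $ j" for i j
    proof -
      have "(\<Sum>a\<in>UNIV. \<Sum>b\<in>UNIV. cscale (A $ a $ b) (E (a, b))) $ i $ j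
          = (\<Sum>a\<in>UNIV. \<Sum>b\<in>UNIV. if b = j then if a = i then A $ i $ j else 0 else 0)"
        unfolding sum_component by (intro sum.cong refl) (auto simp: cscale_def E_def)
      then show ?thesis by simp
    qed
    then have "(\<Sum>a\<in>UNIV. \<Sum>b\<in>UNIV. cscale (A $ a $ b) (E (a, b))) = A"
      by (simp only: vec_eq_iff simp_thms)
    moreover have "(\<Sum>a\<in>UNIV. \<Sum>b\<in>UNIV. cscale (A $ a $ b) (E (a, b))) \<in> cmat.span (range E)"
      by (intro cmat.span_sum cmat.span_scale cmat.span_base rangeI)
    ultimately show ?thesis
      by simp
  qed
  then have "card B \<le> card (range E)"
    using cmat.independent_span_bound[OF _ assms, of "range E"] by auto
  also have "\<dots> \<le> CARD('n \<times> 'n)"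
    by (rule card_image_le) simp
  finally show ?thesis
    by (simp add: power2_eq_square)
qed

text \<open>As long as the chain increases strictly, each step adds an element to an independent set that
starts with the identity matrix. After \<open>n\<^sup>2\<close> strict steps it would have \<open>n\<^sup>2 + 1\<close> elements. Once two
consecutive spaces agree, the recursion keeps the chain constant.\<close>

lemma kraus_space_stabilizes:
  fixes V :: "nat \<Rightarrow> complex^'n^'n"
  assumes "(\<Sum>i=1..m. cadj (V i) ** V i) = mat 1"
  shows "\<exists>k \<le> CARD('n)\<^sup>2 - 1. \<forall>j. kraus_space m V j \<subseteq> kraus_space m V k"
proof -
  have mono: "kraus_space m V i \<subseteq> kraus_space m V j" if "i \<le> j" for i j
    using kraus_space_mono[OF assms] that by (rule lift_Suc_mono_le)
  have "\<exists>k \<le> CARD('n)\<^sup>2 - 1. kraus_space m V (Suc k) = kraus_space m V k"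
  proof (rule ccontr)
    assume contr: "\<not> ?thesis"
    have "\<exists>B. B \<subseteq> kraus_space m V k \<and> finite B \<and> cmat.independent B \<and> card B = Suc k"
      if "k \<le> CARD('n)\<^sup>2" for k
      using that
    proof (induction k)
      case 0
      have "(mat 1 :: complex^'n^'n) \<noteq> 0"
        by (simp add: mat_def vec_eq_iff)
      then have "cmat.independent {mat 1 :: complex^'n^'n}"
        by (subst cmat.dependent_single)
      then show ?case
        by (intro exI[of _ "{mat 1}"]) (simp add: cmat.span_base)
    next
      case (Suc k)
      then obtain B where B: "B \<subseteq> kraus_space m V k" "finite B" "cmat.independent B" "card B = Suc k"
        by auto
      have "kraus_space m V (Suc k) \<noteq> kraus_space m V k"
        using contr Suc.prems by auto
      then obtain b where b: "b \<in> kraus_space m V (Suc k)" "b \<notin> kraus_space m V k"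
        using kraus_space_mono[OF assms] by blast
      have "cmat.span B \<subseteq> kraus_space m V k"
        using B(1) unfolding kraus_space_words by (rule cmat.span_minimal[OF _ cmat.subspace_span])
      with b have "b \<notin> cmat.span B" by blast
      then have "cmat.independent (insert b B)" "b \<notin> B"
        using B(3) cmat.independent_insertI cmat.span_base by auto
      then show ?case
        using B b kraus_space_mono[OF assms, of k] by (intro exI[of _ "insert b B"]) auto
    qed
    from this[of "CARD('n)\<^sup>2"] show False
      using independent_card_le by (metis order_refl not_less_eq_eq)
  qed
  then obtain k where k: "k \<le> CARD('n)\<^sup>2 - 1" "kraus_space m V (Suc k) = kraus_space m V k"
    by blast
  have "kraus_space m V (k + i) = kraus_space m V k" for i
  proof (induction i)
    case (Suc i)
    then have "kraus_space m V (Suc (k + i)) = kraus_space m V (Suc k)"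
      unfolding kraus_space.simps(2) by simp
    then show ?case using k by simp
  qed simp
  then have "kraus_space m V j \<subseteq> kraus_space m V k" for j
    using mono[of j "k + j"] by simp
  with k show ?thesis by blast
qed

section \<open>Contraction of the trace norm\<close>

text \<open>Dobrushin's argument. Let \<open>P\<close> and \<open>N\<close> be the positive and negative parts of \<open>d\<close>; both have the
same mass \<open>M\<close>. Transporting the mass \<open>P i\<close> to \<open>N i'\<close> in proportion \<open>P i * N i' / M\<close> writes the image of
\<open>d\<close> as a combination of differences of rows of \<open>p\<close>, and two rows have \<open>\<ell>\<^sup>1\<close> distance at most
\<open>2 (1 - \<delta>)\<close>, because \<open>\<bar>a - b\<bar> \<le> a + b - 2 a b\<close> for \<open>a, b\<close> in the unit interval.\<close>

lemma stochastic_contraction: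
  fixes d :: "'a::finite \<Rightarrow> real" and p :: "'a \<Rightarrow> 'b::finite \<Rightarrow> real"
  assumes d: "(\<Sum>i\<in>UNIV. d i) = 0"
    and p: "\<And>i j. 0 \<le> p i j" "\<And>i. (\<Sum>j\<in>UNIV. p i j) = 1"
    and overlap: "\<And>i i'. \<delta> \<le> (\<Sum>j\<in>UNIV. p i j * p i' j)"
  shows "(\<Sum>j\<in>UNIV. \<bar>\<Sum>i\<in>UNIV. d i * p i j\<bar>) \<le> (1 - \<delta>) * (\<Sum>i\<in>UNIV. \<bar>d i\<bar>)"
proof -
  define P N M where "P i = max (d i) 0" and "N i = max (- d i) 0" and "M = (\<Sum>i\<in>UNIV. P i)"
    for i
  have PN: "d i = P i - N i" "\<bar>d i\<bar> = P i + N i" "0 \<le> P i" "0 \<le> N i" for i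
    by (auto simp: P_def N_def)
  have N: "(\<Sum>i\<in>UNIV. N i) = M"
    using d by (simp add: PN(1) sum_subtractf M_def)
  have sum_d: "(\<Sum>i\<in>UNIV. \<bar>d i\<bar>) = 2 * M"
    by (simp add: PN(2) sum.distrib N flip: M_def)
  have p_le: "p i j \<le> 1" for i j
    using member_le_sum[of j UNIV "p i"] p by simp
  have dist: "(\<Sum>j\<in>UNIV. \<bar>p i j - p i' j\<bar>) \<le> 2 * (1 - \<delta>)" for i i'
  proof -
    have "\<bar>p i j - p i' j\<bar> \<le> p i j + p i' j - 2 * (p i j * p i' j)" for j
      using mult_left_mono[OF p_le[of i j] p(1)[of i' j]] mult_left_mono[OF p_le[of i' j] p(1)[of i j]]
      by (simp add: mult.commute)
    then have "(\<Sum>j\<in>UNIV. \<bar>p i j - p i' j\<bar>) \<le> (\<Sum>j\<in>UNIV. p i j + p i' j - 2 * (p i j * p i' j))"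
      by (rule sum_mono)
    also have "\<dots> = 2 - 2 * (\<Sum>j\<in>UNIV. p i j * p i' j)"
      by (simp add: sum.distrib sum_subtractf p(2) sum_distrib_left)
    finally show ?thesis
      using overlap[of i i'] by simp
  qed
  have split: "M * (\<Sum>i\<in>UNIV. d i * p i j) = (\<Sum>i\<in>UNIV. \<Sum>i'\<in>UNIV. P i * N i' * (p i j - p i' j))" for j
  proof -
    have "(\<Sum>i\<in>UNIV. \<Sum>i'\<in>UNIV. P i * N i' * (p i j - p i' j))
        = (\<Sum>i\<in>UNIV. P i * p i j) * (\<Sum>i'\<in>UNIV. N i') - (\<Sum>i\<in>UNIV. P i) * (\<Sum>i'\<in>UNIV. N i' * p i' j)"
      by (simp only: sum_product flip: sum_subtractf) (intro sum.cong refl, simp add: algebra_simps)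
    also have "\<dots> = M * (\<Sum>i\<in>UNIV. d i * p i j)"
      by (simp add: N PN(1) left_diff_distrib right_diff_distrib sum_subtractf flip: M_def)
    finally show ?thesis by simp
  qed
  have "M \<ge> 0"
    by (simp add: M_def PN sum_nonneg)
  have "M * (\<Sum>j\<in>UNIV. \<bar>\<Sum>i\<in>UNIV. d i * p i j\<bar>) = (\<Sum>j\<in>UNIV. \<bar>M * (\<Sum>i\<in>UNIV. d i * p i j)\<bar>)"
    using \<open>M \<ge> 0\<close> by (simp add: abs_mult flip: sum_distrib_left)
  also have "\<dots> \<le> (\<Sum>j\<in>UNIV. \<Sum>i\<in>UNIV. \<Sum>i'\<in>UNIV. P i * N i' * \<bar>p i j - p i' j\<bar>)"
    unfolding split
    by (intro sum_mono order_trans[OF sum_abs]) (simp add: abs_mult PN)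
  also have "\<dots> = (\<Sum>i\<in>UNIV. \<Sum>i'\<in>UNIV. \<Sum>j\<in>UNIV. P i * N i' * \<bar>p i j - p i' j\<bar>)"
    by (subst sum.swap) (intro sum.cong refl sum.swap)
  also have "\<dots> \<le> (\<Sum>i\<in>UNIV. \<Sum>i'\<in>UNIV. P i * N i' * (2 * (1 - \<delta>)))"
    unfolding sum_distrib_left[symmetric] by (intro sum_mono mult_left_mono dist) (simp add: PN)
  also have "\<dots> = (\<Sum>i\<in>UNIV. P i) * (\<Sum>i'\<in>UNIV. N i') * (2 * (1 - \<delta>))"
    by (subst sum_product) (simp only: sum_distrib_right)
  also have "\<dots> = M * ((1 - \<delta>) * (2 * M))"
    by (simp add: N flip: M_def)
  finally have *: "M * (\<Sum>j\<in>UNIV. \<bar>\<Sum>i\<in>UNIV. d i * p i j\<bar>) \<le> M * ((1 - \<delta>) * (2 * M))" .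
  show ?thesis
  proof (cases "M = 0")
    case True
    then have "(\<Sum>i\<in>UNIV. \<bar>d i\<bar>) = 0"
      using sum_d by simp
    then have "d i = 0" for i
      by (simp add: sum_nonneg_eq_0_iff)
    then show ?thesis by simp
  next
    case False
    with * \<open>M \<ge> 0\<close> show ?thesis
      unfolding sum_d by (intro mult_left_le_imp_le[OF *]) simp
  qed
qed

lemma kraus_norm:
  assumes "(\<Sum>w\<in>I. cadj (W w) ** W w) = mat 1"
  shows "(\<Sum>w\<in>I. (norm (W w *v x))\<^sup>2) = (norm x)\<^sup>2"
proof -
  have "complex_of_real (\<Sum>w\<in>I. (norm (W w *v x))\<^sup>2) = (\<Sum>w\<in>I. hdot (W w *v x) (W w *v x))"
    by (simp add: hdot_self)
  also have "\<dots> = hdot x ((\<Sum>w\<in>I. cadj (W w) ** W w) *v x)"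
    by (simp add: hdot_matrix_left sum_matrix_vector hdot_sum_right matrix_vector_mul_assoc)
  also have "\<dots> = of_real ((norm x)\<^sup>2)"
    by (simp add: assms hdot_self)
  finally show ?thesis
    by (simp only: of_real_eq_iff)
qed

lemma quadratic_form_eigenbasis:
  assumes f: "orthonormal f" and d: "\<And>i. X *v f i = of_real (d i) *s f i" and X: "hermitian X"
  shows "hdot z (X *v z) = of_real (\<Sum>i\<in>UNIV. d i * (cmod (hdot (f i) z))\<^sup>2)"
proof -
  have "hdot (f i) (X *v z) = of_real (d i) * hdot (f i) z" for i
    using X by (simp add: hdot_matrix_right hermitian_def d hdot_scale_left)
  then have "hdot z (X *v z) = (\<Sum>i\<in>UNIV. of_real (d i) * (hdot (f i) z * cnj (hdot (f i) z)))"
    unfolding parseval[OF f, of z "X *v z"] by (simp add: cnj_hdot mult_ac)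
  then show ?thesis
    by (simp add: del: of_real_power flip: complex_norm_square)
qed

text \<open>Expand the inner product in the basis and apply the Cauchy-Schwarz inequality to the \<open>n\<close> terms.\<close>

lemma cmod_hdot_le_sum:
  fixes f :: "'n::finite \<Rightarrow> complex^'n"
  assumes f: "orthonormal f"
  shows "(cmod (hdot x y))\<^sup>2
    \<le> real CARD('n) * (\<Sum>j\<in>UNIV. (cmod (hdot x (f j)))\<^sup>2 * (cmod (hdot y (f j)))\<^sup>2)"
proof -
  have "cmod (hdot x y) \<le> (\<Sum>j\<in>UNIV. cmod (hdot x (f j) * hdot (f j) y))"
    unfolding parseval[OF f, of x y] by (rule norm_sum)
  also have "\<dots> = (\<Sum>j\<in>UNIV. cmod (hdot x (f j)) * cmod (hdot y (f j)))"
    by (simp add: norm_mult cmod_hdot_commute)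
  finally have "(cmod (hdot x y))\<^sup>2 \<le> (\<Sum>j\<in>UNIV. cmod (hdot x (f j)) * cmod (hdot y (f j)))\<^sup>2"
    by (intro power_mono) auto
  also have "\<dots> \<le> (\<Sum>j\<in>UNIV. (cmod (hdot x (f j)) * cmod (hdot y (f j)))\<^sup>2) * real CARD('n)"
    by (rule sum_squared_le_sum_of_squares)
  finally show ?thesis
    by (simp add: power_mult_distrib mult.commute)
qed

text \<open>In an eigenbasis \<open>f\<close> of \<open>D\<close> and an eigenbasis \<open>g\<close> of its image, the eigenvalues \<open>d\<close> and \<open>e\<close> are
related by \<open>e\<^sub>j = (\<Sum>\<^sub>i d\<^sub>i p\<^sub>i\<^sub>j)\<close> with the stochastic matrix \<open>p\<close> of the transition probabilities from
\<open>f\<^sub>i\<close> to \<open>g\<^sub>j\<close>. The numbers \<open>d\<close> sum to zero as \<open>D\<close> is traceless, and the rows of \<open>p\<close> overlap by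
\<open>cmod_hdot_le_sum\<close> and the hypothesis on \<open>W\<close>.\<close>

lemma kraus_trace_norm_contraction:
  fixes W :: "'i \<Rightarrow> complex^'n^'n"
  assumes iso: "(\<Sum>w\<in>I. cadj (W w) ** W w) = mat 1"
    and overlap: "\<And>x y. norm x = 1 \<Longrightarrow> norm y = 1 \<Longrightarrow>
        \<eta> \<le> (\<Sum>a\<in>I. \<Sum>b\<in>I. (cmod (hdot (W a *v x) (W b *v y)))\<^sup>2)"
    and D: "hermitian D" "trace D = 0"
  shows "trace_norm (\<Sum>w\<in>I. W w ** D ** cadj (W w)) \<le> (1 - \<eta> / real CARD('n)) * trace_norm D"
proof -
  define T where "T = (\<Sum>w\<in>I. W w ** D ** cadj (W w))"
  obtain f d where f: "orthonormal f" and d: "\<And>i. D *v f i = of_real (d i) *s f i"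
    using hermitian_eigenbasis[OF D(1)] by blast
  obtain g e where g: "orthonormal g" and e: "\<And>i. T *v g i = of_real (e i) *s g i"
    using hermitian_eigenbasis[OF hermitian_sandwich[OF D(1), of W I]] unfolding T_def by blast
  define p where "p i j = (\<Sum>w\<in>I. (cmod (hdot (W w *v f i) (g j)))\<^sup>2)" for i j
  have nf: "norm (f i) = 1" for i
    by (rule orthonormal_norm[OF f])
  have e_eq: "e j = (\<Sum>i\<in>UNIV. d i * p i j)" for j
  proof -
    have "hdot (g j) (T *v g j) = (\<Sum>w\<in>I. hdot (cadj (W w) *v g j) (D *v (cadj (W w) *v g j)))"
      by (simp add: T_def sum_matrix_vector hdot_sum_right hdot_sandwich)
    also have "\<dots> = of_real (\<Sum>w\<in>I. \<Sum>i\<in>UNIV. d i * (cmod (hdot (W w *v f i) (g j)))\<^sup>2)"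
      by (simp only: quadratic_form_eigenbasis[OF f d D(1)] hdot_matrix_left of_real_sum)
    also have "\<dots> = of_real (\<Sum>i\<in>UNIV. d i * p i j)"
      by (subst sum.swap) (simp add: p_def sum_distrib_left)
    finally show ?thesis
      using eigenvalue_hdot[OF g e, of j] by simp
  qed
  have p_sum: "(\<Sum>j\<in>UNIV. p i j) = 1" for i
  proof -
    have "(\<Sum>j\<in>UNIV. p i j) = (\<Sum>w\<in>I. \<Sum>j\<in>UNIV. (cmod (hdot (g j) (W w *v f i)))\<^sup>2)"
      unfolding p_def by (subst sum.swap) (simp add: cmod_hdot_commute)
    then show ?thesis
      by (simp add: kraus_norm[OF iso] nf flip: parseval_norm[OF g])
  qed
  have p_overlap: "\<eta> / real CARD('n) \<le> (\<Sum>j\<in>UNIV. p i j * p i' j)" for i i'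
  proof -
    let ?u = "\<lambda>a i j. (cmod (hdot (W a *v f i) (g j)))\<^sup>2"
    have "\<eta> \<le> (\<Sum>a\<in>I. \<Sum>b\<in>I. (cmod (hdot (W a *v f i) (W b *v f i')))\<^sup>2)"
      by (intro overlap nf)
    also have "\<dots> \<le> (\<Sum>a\<in>I. \<Sum>b\<in>I. real CARD('n) * (\<Sum>j\<in>UNIV. ?u a i j * ?u b i' j))"
      by (intro sum_mono cmod_hdot_le_sum g)
    also have "\<dots> = real CARD('n) * (\<Sum>a\<in>I. \<Sum>j\<in>UNIV. \<Sum>b\<in>I. ?u a i j * ?u b i' j)"
      unfolding sum_distrib_left by (rule sum.cong[OF refl], rule sum.swap)
    also have "\<dots> = real CARD('n) * (\<Sum>j\<in>UNIV. p i j * p i' j)"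
      by (subst sum.swap) (simp add: p_def sum_product)
    finally show ?thesis
      by (simp add: field_simps)
  qed
  have "(\<Sum>i\<in>UNIV. d i) = Re (trace D)"
    unfolding trace_orthonormal[OF f, of D] Re_sum
    by (intro sum.cong refl eigenvalue_hdot[OF f d])
  then have "(\<Sum>i\<in>UNIV. d i) = 0"
    using D by simp
  from stochastic_contraction[OF this _ p_sum p_overlap]
  have "(\<Sum>j\<in>UNIV. \<bar>e j\<bar>) \<le> (1 - \<eta> / real CARD('n)) * (\<Sum>i\<in>UNIV. \<bar>d i\<bar>)"
    unfolding e_eq by (simp add: p_def sum_nonneg)
  then show ?thesis
    by (simp add: trace_norm_eigenbasis[OF f d] trace_norm_eigenbasis[OF g e] flip: T_def)
qed

text \<open>The overlap is a continuous function on the product of two unit spheres, and it is positive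
there, so its minimum serves as the bound.\<close>

lemma overlap_lower_bound:
  fixes W :: "'i \<Rightarrow> complex^'n^'n"
  assumes fin: "finite I"
    and ex: "\<And>x y. x \<noteq> 0 \<Longrightarrow> y \<noteq> 0 \<Longrightarrow> \<exists>a\<in>I. \<exists>b\<in>I. hdot (W a *v x) (W b *v y) \<noteq> 0"
  shows "\<exists>\<eta>>0. \<forall>x y. norm x = 1 \<longrightarrow> norm y = 1 \<longrightarrow>
    \<eta> \<le> (\<Sum>a\<in>I. \<Sum>b\<in>I. (cmod (hdot (W a *v x) (W b *v y)))\<^sup>2)"
proof -
  let ?S = "sphere (0 :: complex^'n) 1"
  let ?h = "\<lambda>(x, y). \<Sum>a\<in>I. \<Sum>b\<in>I. (cmod (hdot (W a *v x) (W b *v y)))\<^sup>2"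
  have cont: "continuous_on (?S \<times> ?S) ?h"
    unfolding case_prod_unfold by (intro continuous_intros)
  have "axis undefined 1 \<in> ?S"
    by (simp add: norm_axis_1)
  then have ne: "?S \<times> ?S \<noteq> {}"
    by blast
  have "compact (?S \<times> ?S)"
    by (intro compact_Times compact_sphere)
  from continuous_attains_inf[OF this ne cont] obtain u v
    where uv: "norm u = 1" "norm v = 1" and min: "\<And>x y. norm x = 1 \<Longrightarrow> norm y = 1 \<Longrightarrow> ?h (u, v) \<le> ?h (x, y)"
    by fastforce
  obtain a b where ab: "a \<in> I" "b \<in> I" "hdot (W a *v u) (W b *v v) \<noteq> 0"
    using ex[of u v] uv by fastforce
  have "0 < (cmod (hdot (W a *v u) (W b *v v)))\<^sup>2"
    using ab by simp
  also have "\<dots> \<le> (\<Sum>b\<in>I. (cmod (hdot (W a *v u) (W b *v v)))\<^sup>2)"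
    using ab fin by (intro member_le_sum) auto
  also have "\<dots> \<le> ?h (u, v)"
    unfolding prod.case using ab fin
    by (intro member_le_sum[where f = "\<lambda>a. \<Sum>b\<in>I. (cmod (hdot (W a *v u) (W b *v v)))\<^sup>2"])
      (auto intro: sum_nonneg)
  finally show ?thesis
    using min by (intro exI[of _ "?h (u, v)"]) simp
qed

lemma trace_norm_zero: "trace_norm (0 :: complex^'n^'n) = 0"
proof -
  have "hermitian (0 :: complex^'n^'n)"
    by (simp add: hermitian_def cadj_def vec_eq_iff)
  then obtain f d where f: "orthonormal f" and d: "\<And>i. (0 :: complex^'n^'n) *v f i = of_real (d i) *s f i"
    using hermitian_eigenbasis by blast
  have "d i = 0" for i
    using eigenvalue_hdot[OF f d, of i] by simp
  then show ?thesis
    by (simp add: trace_norm_eigenbasis[OF f d])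
qed

lemma trace_norm_pos:
  assumes "hermitian X" "X \<noteq> 0"
  shows "0 < trace_norm X"
  using norm_le_trace_norm[OF assms(1)] trace_norm_nonneg[OF assms(1)] assms(2)
  by (metis less_eq_real_def mult_zero_right norm_le_zero_iff)

section \<open>Norms below one as Lipschitz bounds\<close>

text \<open>It is the supremum in the definition that makes a uniform \<open>c\<close> necessary: quotients that are
merely smaller than \<open>1\<close> could still have supremum \<open>1\<close>.\<close>

lemma dual_hilbert_norm_less_1I:
  assumes "c < 1"
    and "\<And>A B. A \<in> density_matrices \<Longrightarrow> B \<in> density_matrices \<Longrightarrow>
      trace_norm (F A - F B) \<le> c * trace_norm (A - B)"
  shows "dual_hilbert_norm F < 1"
proof -
  have "dual_hilbert_norm F \<le> ennreal (max c 0)"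
    unfolding dual_hilbert_norm_def
  proof (rule SUP_least, clarify)
    fix A B :: "complex^'a^'a"
    assume AB: "A \<in> density_matrices" "B \<in> density_matrices" "A \<noteq> B"
    have "0 < trace_norm (A - B)"
      using AB by (intro trace_norm_pos hermitian_diff density_hermitian) auto
    then have "trace_norm (F A - F B) / trace_norm (A - B) \<le> c"
      using assms(2)[OF AB(1,2)] by (simp add: divide_le_eq)
    then show "ennreal (trace_norm (F A - F B) / trace_norm (A - B)) \<le> ennreal (max c 0)"
      by (intro ennreal_leI) simp
  qed
  also have "\<dots> < 1"
    using assms(1) by (simp add: ennreal_less_one_iff)
  finally show ?thesis .
qed

lemma dual_hilbert_norm_less_1D:
  fixes F :: "complex^'n^'n \<Rightarrow> complex^'n^'n"
  assumes "dual_hilbert_norm F < 1"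
  shows "\<exists>c. 0 \<le> c \<and> c < 1 \<and> (\<forall>A\<in>density_matrices. \<forall>B\<in>density_matrices.
    trace_norm (F A - F B) \<le> c * trace_norm (A - B))"
proof -
  obtain c where c: "0 \<le> c" "dual_hilbert_norm F = ennreal c"
    using assms by (cases "dual_hilbert_norm F") auto
  then have "c < 1"
    using assms by (simp add: ennreal_less_one_iff)
  moreover have "trace_norm (F A - F B) \<le> c * trace_norm (A - B)"
    if AB: "A \<in> density_matrices" "B \<in> density_matrices" for A B
  proof (cases "A = B")
    case False
    then have pos: "0 < trace_norm (A - B)"
      using AB by (intro trace_norm_pos hermitian_diff density_hermitian) auto
    have "ennreal (trace_norm (F A - F B) / trace_norm (A - B)) \<le> ennreal c"
      unfolding c(2)[symmetric] dual_hilbert_norm_def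
      by (rule SUP_upper2[of "(A, B)"]) (use AB False in auto)
    then have "trace_norm (F A - F B) / trace_norm (A - B) \<le> c"
      using c(1) by (simp add: ennreal_le_iff)
    then show ?thesis
      using pos by (simp add: divide_le_eq)
  qed (simp add: trace_norm_zero)
  ultimately show ?thesis
    using c(1) by blast
qed

lemma kraus_iterate_diff:
  "(kraus_map m V ^^ k) (A - B) = (kraus_map m V ^^ k) A - (kraus_map m V ^^ k) B"
  by (simp add: kraus_iterate sandwich_diff sum_subtractf)

section \<open>Convergence to the invariant density matrix\<close>

text \<open>Every \<open>n \<ge> 1\<close> beyond \<open>q k\<close> is \<open>q\<close> contractions away from an index where the bound \<open>B\<close> holds.
This reasoning also covers \<open>k = 0\<close>, where the contraction forces \<open>t\<close> to vanish.\<close>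

lemma periodic_contraction_tendsto_0:
  fixes t :: "nat \<Rightarrow> real"
  assumes t: "\<And>n. n \<ge> 1 \<Longrightarrow> 0 \<le> t n" "\<And>n. n \<ge> 1 \<Longrightarrow> t n \<le> B"
    and c: "0 \<le> c" "c < 1"
    and contr: "\<And>n. n \<ge> 1 \<Longrightarrow> t (n + k) \<le> c * t n"
  shows "t \<longlonglongrightarrow> 0"
proof (rule LIMSEQ_I)
  fix r :: real assume "0 < r"
  have le: "t (n + q * k) \<le> c ^ q * B" if "n \<ge> 1" for n q
  proof (induction q)
    case (Suc q)
    have "t (n + Suc q * k) = t ((n + q * k) + k)"
      by (simp add: algebra_simps)
    also have "\<dots> \<le> c * t (n + q * k)"
      using that by (intro contr) simp
    also have "\<dots> \<le> c * (c ^ q * B)"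
      using Suc c by (intro mult_left_mono) auto
    finally show ?case by (simp add: mult_ac)
  qed (use t that in simp)
  have "(\<lambda>q. c ^ q * B) \<longlonglongrightarrow> 0 * B"
    using c by (intro tendsto_mult LIMSEQ_power_zero tendsto_const) simp
  then have "eventually (\<lambda>q. c ^ q * B < r) sequentially"
    using \<open>0 < r\<close> by (intro order_tendstoD(2)[of _ "0 * B"]) auto
  then obtain q where q: "c ^ q * B < r"
    by (auto simp: eventually_sequentially)
  show "\<exists>n0. \<forall>n\<ge>n0. norm (t n - 0) < r"
  proof (intro exI allI impI)
    fix n assume "n \<ge> Suc (q * k)"
    then have "1 \<le> n - q * k" "n - q * k + q * k = n" "1 \<le> n"
      by linarith+
    then have "t n < r" "0 \<le> t n"
      using le[of "n - q * k" q] q t(1)[of n] by auto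
    then show "norm (t n - 0) < r" by simp
  qed
qed

lemma kraus_orbit:
  assumes "\<And>n. n \<ge> 1 \<Longrightarrow> R (n + 1) = F (R n)" "n \<ge> 1"
  shows "R (n + k) = (F ^^ k) (R n)"
  using assms by (induction k) auto

lemma contraction_imp_convergence:
  fixes V :: "nat \<Rightarrow> complex^'n^'n"
  assumes V: "(\<Sum>i=1..m. cadj (V i) ** V i) = mat 1"
    and k: "dual_hilbert_norm (kraus_map m V ^^ k) < 1"
  shows "converges_to_unique_invariant (kraus_map m V)"
proof -
  let ?F = "kraus_map m V"
  obtain c where c: "0 \<le> c" "c < 1"
    and contr: "\<And>A B. A \<in> density_matrices \<Longrightarrow> B \<in> density_matrices \<Longrightarrow>
      trace_norm ((?F ^^ k) A - (?F ^^ k) B) \<le> c * trace_norm (A - B)"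
    using dual_hilbert_norm_less_1D[OF k] by blast
  have "?F \<in> density_matrices \<rightarrow> density_matrices"
    using kraus_map_density[OF V] by blast
  with brouwer[OF compact_density_matrices convex_density_matrices density_matrices_nonempty
      continuous_on_kraus_map]
  obtain P where P: "P \<in> density_matrices" "?F P = P"
    by metis
  have P_iter: "(?F ^^ j) P = P" for j
    by (induction j) (simp_all add: P)
  have conv: "R \<longlonglongrightarrow> P" if R: "R 1 \<in> density_matrices" "\<forall>n\<ge>1. R (n + 1) = ?F (R n)" for R
  proof -
    have dens: "R n \<in> density_matrices" if "n \<ge> 1" for n
      using that
    proof (induction n rule: dec_induct)
      case (step n)
      then show ?case using R(2) kraus_map_density[OF V] by simp
    qed (use R in simp)
    have herm: "hermitian (R n - P)" if "n \<ge> 1" for n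
      using dens[OF that] P by (intro hermitian_diff density_hermitian)
    have "(\<lambda>n. trace_norm (R n - P)) \<longlonglongrightarrow> 0"
    proof (rule periodic_contraction_tendsto_0)
      fix n :: nat assume n: "n \<ge> 1"
      show "0 \<le> trace_norm (R n - P)"
        using herm[OF n] by (rule trace_norm_nonneg)
      show "trace_norm (R n - P) \<le> 2"
        using dens[OF n] P(1) by (rule trace_norm_density_diff_le)
      have "R (n + k) = (?F ^^ k) (R n)"
        using R(2) n by (intro kraus_orbit) auto
      then show "trace_norm (R (n + k) - P) \<le> c * trace_norm (R n - P)"
        using contr[OF dens[OF n] P(1)] by (simp add: P_iter)
    qed (use c in auto)
    then have "(\<lambda>n. real (CARD('n)\<^sup>2) * trace_norm (R n - P)) \<longlonglongrightarrow> 0"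
      by (rule tendsto_mult_right_zero)
    moreover have "eventually (\<lambda>n. norm (R n - P) \<le> real (CARD('n)\<^sup>2) * trace_norm (R n - P)) sequentially"
      using norm_le_trace_norm[OF herm] by (auto simp: eventually_sequentially)
    ultimately have "(\<lambda>n. R n - P) \<longlonglongrightarrow> 0"
      by (rule Lim_null_comparison[rotated])
    then show ?thesis
      by (rule LIM_zero_cancel)
  qed
  have "Q = P" if Q: "Q \<in> density_matrices" "?F Q = Q" for Q
  proof -
    have "(\<lambda>n. Q) \<longlonglongrightarrow> P"
      using Q by (intro conv) auto
    then show ?thesis
      by (simp add: LIMSEQ_const_iff)
  qed
  with P conv show ?thesis
    unfolding converges_to_unique_invariant_def by blast
qed

section \<open>The equivalence\<close>

text \<open>The product of the images of two pure states under \<open>A\<close> and \<open>B\<close> vanishes if the image vectors are orthogonal.\<close>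

lemma sandwich_outer_mult:
  fixes A B :: "complex^'n^'n"
  shows "(A ** outer x x ** cadj A) ** (B ** outer y y ** cadj B)
    = cscale (hdot (A *v x) (B *v y)) (outer (A *v x) (B *v y))"
proof -
  have sandwich: "C ** outer z z ** cadj C = outer (C *v z) (C *v z)" for C :: "complex^'n^'n" and z
    by (simp add: matrix_eq hdot_matrix_left vec.scale outer_matrix_vector flip: matrix_vector_mul_assoc)
  show ?thesis
    unfolding sandwich
    by (simp add: outer_def cscale_def hdot_def matrix_matrix_mult_def vec_eq_iff
        sum_distrib_left sum_distrib_right mult_ac)
qed

text \<open>If the pure states of \<open>x\<close> and \<open>y\<close> stayed orthogonal forever, their common limit \<open>P\<close> would
satisfy \<open>P P = 0\<close>. The diagonal entries of \<open>P P\<close> are the squared norms of the rows of \<open>P\<close>.\<close>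

lemma convergence_imp_no_rank_1:
  fixes V :: "nat \<Rightarrow> complex^'n^'n"
  assumes V: "(\<Sum>i=1..m. cadj (V i) ** V i) = mat 1"
    and conv: "converges_to_unique_invariant (kraus_map m V)"
    and A: "A \<in> (\<Inter>k. orth_compl (kraus_space m V k))"
  shows "rank A \<noteq> 1"
proof
  let ?F = "kraus_map m V"
  assume "rank A = 1"
  then obtain x y where xy: "x \<noteq> 0" "y \<noteq> 0" "A = outer x y"
    unfolding rank_1_iff_outer by blast
  obtain P where P: "P \<in> density_matrices"
    and lim: "\<And>R. R 1 \<in> density_matrices \<Longrightarrow> \<forall>k\<ge>1. R (k + 1) = ?F (R k) \<Longrightarrow> R \<longlonglongrightarrow> P"
    using conv unfolding converges_to_unique_invariant_def by blast
  define u where "u z = inverse (complex_of_real (norm z)) *s z" for z :: "complex^'n"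
  have norm_u: "norm (u z) = 1" if "z \<noteq> 0" for z
  proof -
    have "u z = inverse (norm z) *\<^sub>R z"
      by (simp add: u_def vec_eq_iff scaleR_conv_of_real[where 'a = complex])
    then show ?thesis using that by simp
  qed
  have orbit: "(\<lambda>k. (?F ^^ k) (outer (u z) (u z))) \<longlonglongrightarrow> P" if "z \<noteq> 0" for z
    using kraus_iterate_density[OF V outer_density[OF norm_u[OF that]], of 1] by (intro lim) simp_all
  have zero: "(?F ^^ k) (outer (u x) (u x)) ** (?F ^^ k) (outer (u y) (u y)) = 0" for k
  proof -
    have "hdot (kraus_word V a *v u x) (kraus_word V b *v u y) = 0"
      if "a \<in> words m k" "b \<in> words m k" for a b
      using A that unfolding xy(3)
      by (simp add: outer_orthogonal_kraus_space u_def vec.scale hdot_scale_left hdot_scale_right)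
    then show ?thesis
      by (simp add: kraus_iterate sum_matrix_mult_left sum_matrix_mult_right sandwich_outer_mult
          cscale_def vec_eq_iff)
  qed
  have "(\<lambda>k. (?F ^^ k) (outer (u x) (u x)) ** (?F ^^ k) (outer (u y) (u y))) \<longlonglongrightarrow> P ** P"
    unfolding matrix_matrix_mult_def
    by (intro tendsto_intros tendsto_vec_lambda orbit xy)
  then have PP: "P ** P = 0"
    by (simp add: zero LIMSEQ_const_iff)
  have "P $ i $ j = 0" for i j
  proof -
    have cnj_P: "P $ k $ i = cnj (P $ i $ k)" for k
      using density_hermitian[OF P] by (simp add: hermitian_def cadj_def vec_eq_iff)
    have "(P ** P) $ i $ i = (\<Sum>k\<in>UNIV. P $ i $ k * P $ k $ i)"
      by (simp add: matrix_matrix_mult_def)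
    also have "\<dots> = of_real (\<Sum>k\<in>UNIV. (cmod (P $ i $ k))\<^sup>2)"
      by (simp only: cnj_P of_real_sum complex_norm_square)
    finally have "complex_of_real (\<Sum>k\<in>UNIV. (cmod (P $ i $ k))\<^sup>2) = 0"
      unfolding PP by (simp only: zero_index)
    then have "(\<Sum>k\<in>UNIV. (cmod (P $ i $ k))\<^sup>2) = 0"
      by (simp only: of_real_eq_0_iff)
    then show ?thesis
      by (simp add: sum_nonneg_eq_0_iff)
  qed
  then have "trace P = 0"
    by (simp add: trace_def)
  with P show False
    by (simp add: density_matrices_def)
qed

lemma no_rank_1_imp_contraction:
  fixes V :: "nat \<Rightarrow> complex^'n^'n"
  assumes V: "(\<Sum>i=1..m. cadj (V i) ** V i) = mat 1"
    and no_rank_1: "\<And>A. A \<in> orth_compl (kraus_space m V k) \<Longrightarrow> rank A \<noteq> 1"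
  shows "dual_hilbert_norm (kraus_map m V ^^ k) < 1"
proof -
  let ?W = "kraus_word V" and ?I = "words m k"
  have "\<exists>a\<in>?I. \<exists>b\<in>?I. hdot (?W a *v x) (?W b *v y) \<noteq> 0" if "x \<noteq> 0" "y \<noteq> 0" for x y
    using no_rank_1[of "outer x y"] that
    unfolding outer_orthogonal_kraus_space rank_1_iff_outer by blast
  from overlap_lower_bound[OF finite_words this] obtain \<eta> where \<eta>: "\<eta> > 0"
    "\<And>x y. norm x = 1 \<Longrightarrow> norm y = 1 \<Longrightarrow> \<eta> \<le> (\<Sum>a\<in>?I. \<Sum>b\<in>?I. (cmod (hdot (?W a *v x) (?W b *v y)))\<^sup>2)"
    by blast
  show ?thesis
  proof (rule dual_hilbert_norm_less_1I)
    show "1 - \<eta> / real CARD('n) < 1"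
      using \<eta> by simp
    fix A B :: "complex^'n^'n"
    assume AB: "A \<in> density_matrices" "B \<in> density_matrices"
    then have "hermitian (A - B)" "trace (A - B) = 0"
      by (simp_all add: hermitian_diff density_hermitian trace_sub density_matrices_def)
    then have "trace_norm ((kraus_map m V ^^ k) (A - B)) \<le> (1 - \<eta> / real CARD('n)) * trace_norm (A - B)"
      unfolding kraus_iterate
      by (intro kraus_trace_norm_contraction[OF kraus_word_isometry[OF V] \<eta>(2)])
    then show "trace_norm ((kraus_map m V ^^ k) A - (kraus_map m V ^^ k) B)
        \<le> (1 - \<eta> / real CARD('n)) * trace_norm (A - B)"
      by (simp only: kraus_iterate_diff)
  qed
qed

theorem theorem7p8:
  fixes V :: "nat \<Rightarrow> complex^'n^'n" and m :: nat
  assumes "(\<Sum>i=1..m. cadj (V i) ** V i) = mat 1"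
  shows "((\<exists>k::nat. dual_hilbert_norm (kraus_map m V ^^ k) < 1)
            \<longleftrightarrow> converges_to_unique_invariant (kraus_map m V))
       \<and> (converges_to_unique_invariant (kraus_map m V)
            \<longleftrightarrow> \<not> (\<exists>A. A \<in> (\<Inter>k::nat. orth_compl (kraus_space m V k)) \<and> rank A = 1))
       \<and> (\<not> (\<exists>A. A \<in> (\<Inter>k::nat. orth_compl (kraus_space m V k)) \<and> rank A = 1)
            \<longleftrightarrow> (\<exists>k\<^sub>0::nat. k\<^sub>0 \<le> CARD('n) ^ 2 - 1 \<and> dual_hilbert_norm (kraus_map m V ^^ k\<^sub>0) < 1))"
    (is "(?contraction \<longleftrightarrow> ?convergence) \<and> (_ \<longleftrightarrow> ?no_rank_1) \<and> (_ \<longleftrightarrow> ?early_contraction)")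
proof -
  have "?convergence" if ?contraction
    using that contraction_imp_convergence[OF assms] by blast
  moreover have "?no_rank_1" if ?convergence
    using convergence_imp_no_rank_1[OF assms that] by blast
  moreover have "?early_contraction" if ?no_rank_1
  proof -
    obtain k where k: "k \<le> CARD('n)\<^sup>2 - 1" "\<And>j. kraus_space m V j \<subseteq> kraus_space m V k"
      using kraus_space_stabilizes[OF assms] by blast
    have "orth_compl (kraus_space m V k) \<subseteq> (\<Inter>j. orth_compl (kraus_space m V j))"
      using k(2) by (auto simp: orth_compl_def)
    with that have "dual_hilbert_norm (kraus_map m V ^^ k) < 1"
      by (intro no_rank_1_imp_contraction[OF assms]) blast
    with k(1) show ?thesis by blast
  qed
  moreover have ?contraction if ?early_contraction
    using that by blast
  ultimately show ?thesis by blast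
qed

end
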